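(* Let $\mu>0$ and $\nu\in(0,1]$. The distribution $\tilde u^\mu_\nu(x,t)=\int_0^\infty\tilde g^1_\mu(x,s)\,l_\nu(s,t)\,ds$, $x>0$, $t>0$, solves the fractional equation $$\frac{\partial^\nu}{\partial t^\nu}\tilde u^\mu_\nu=\left(x\frac{\partial^2}{\partial x^2}-(\mu-2)\frac{\partial}{\partial x}\right)\tilde u^\mu_\nu,\qquad x>0,\ t>0.$$
   Context: $\tilde g^1_\mu(x,s)=\frac{x^{\mu-1}}{s^{\mu}\Gamma(\mu)}e^{-x/s}$, $x,s>0$. For $\nu\in(0,1)$, $h_\nu(\cdot,t)$ is the density of the $\nu$-stable subordinator $\tilde\tau^{(\nu)}_t$ (non-decreasing Lévy process with $E\exp\{-\lambda\tilde\tau^{(\nu)}_t\}=\exp\{-t\lambda^\nu\}$, $\lambda>0$), $L^{(\nu)}_t$ is its inverse process, $\Pr\{L^{(\nu)}_t<x\}=\Pr\{\tilde\tau^{(\nu)}_x>t\}$, and $l_\nu(x,t)=\int_t^\infty\frac{\partial}{\partial x}h_\nu(s,x)\,ds$ is the density of $L^{(\nu)}_t$. For $\nu=1$, $L^{(1)}_t=t$, so $l_1(s,t)\,ds$ is the unit point mass at $s=t$ and $\tilde u^\mu_1=\tilde g^1_\mu$. $\frac{\partial^\nu}{\partial t^\nu}$ is the Dzerbayshan–Caputo fractional derivative: for $0<\nu<1$, $\frac{d^\nu}{dt^\nu}f(t)=\frac{1}{\Gamma(1-\nu)}\int_0^t(t-s)^{-\nu}f'(s)\,ds$; for $\nu=1$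 it is the ordinary derivative. *)

theory Defs
  imports "HOL-Probability.Probability"
begin

locale levy_process = prob_space M
  for M :: "'a measure" and X :: "real \<Rightarrow> 'a \<Rightarrow> real" +
  assumes rv: "0 \<le> t \<Longrightarrow> random_variable borel (X t)"
    and start: "AE \<omega> in M. X 0 \<omega> = 0"
    and indep_increments:
      "0 \<le> r 0 \<Longrightarrow> (\<forall>i<n. r i < r (Suc i)) \<Longrightarrow>
        indep_vars (\<lambda>_. borel) (\<lambda>i \<omega>. X (r (Suc i)) \<omega> - X (r i) \<omega>) {..<n::nat}"
    and stationary_increments:
      "0 \<le> s \<Longrightarrow> 0 \<le> t \<Longrightarrow> distr M borel (\<lambda>\<omega>. X (s + t) \<omega> - X s \<omega>) = distr M borel (X t)"
    and stochastically_continuous: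
      "0 \<le> s \<Longrightarrow> 0 < \<epsilon> \<Longrightarrow>
        ((\<lambda>t. \<P>(\<omega> in M. \<epsilon> < \<bar>X t \<omega> - X s \<omega>\<bar>)) \<longlongrightarrow> 0) (at s within {0..})"

locale stable_subordinator = levy_process M \<tau>
  for M :: "'a measure" and \<tau> :: "real \<Rightarrow> 'a \<Rightarrow> real" and \<nu> :: real +
  assumes index: "0 < \<nu>" "\<nu> < 1"
    and nondecreasing: "AE \<omega> in M. \<forall>s t. 0 \<le> s \<and> s \<le> t \<longrightarrow> \<tau> s \<omega> \<le> \<tau> t \<omega>"
    and laplace:
      "0 \<le> t \<Longrightarrow> 0 < q \<Longrightarrow> expectation (\<lambda>\<omega>. exp (- q * \<tau> t \<omega>)) = exp (- t * q powr \<nu>)"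

text \<open>A density is determined by the law only almost everywhere, and \<open>inverse_density\<close> below
  differentiates \<open>h\<close> in the time argument; hence \<open>h\<close> is required to be the continuous
  version of the density on the positive half-line, where it is unique.
  The arguments of \<open>h\<close> are space, then time.\<close>

definition density_of_subordinator ::
    "'a measure \<Rightarrow> (real \<Rightarrow> 'a \<Rightarrow> real) \<Rightarrow> (real \<Rightarrow> real \<Rightarrow> real) \<Rightarrow> bool" where
  "density_of_subordinator M \<tau> h \<longleftrightarrow>
    (\<forall>t>0. (\<forall>x>0. 0 \<le> h x t) \<and> continuous_on {0<..} (\<lambda>x. h x t) \<and>
      distributed M lborel (\<tau> t) (\<lambda>x. ennreal (h x t) * indicator {0<..} x))"

definition inverse_density :: "(real \<Rightarrow> real \<Rightarrow> real) \<Rightarrow> real \<Rightarrow> real \<Rightarrow> real" where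
  "inverse_density h x t = (LINT s:{t<..}|lborel. deriv (\<lambda>y. h s y) x)"

definition g_tilde :: "real \<Rightarrow> real \<Rightarrow> real \<Rightarrow> real" where
  "g_tilde \<mu> x s = x powr (\<mu> - 1) / (s powr \<mu> * Gamma \<mu>) * exp (- x / s)"

text \<open>For \<open>\<nu> = 1\<close> the law of the inverse process at time \<open>t\<close> is the unit point mass at \<open>t\<close>,
  so that the mixture is \<open>g_tilde\<close> itself and \<open>h\<close> plays no role.\<close>

definition u_tilde ::
    "(real \<Rightarrow> real \<Rightarrow> real) \<Rightarrow> real \<Rightarrow> real \<Rightarrow> real \<Rightarrow> real \<Rightarrow> real" where
  "u_tilde h \<mu> \<nu> x t =
    (if \<nu> = 1 then g_tilde \<mu> x t
     else (LINT s:{0<..}|lborel. g_tilde \<mu> x s * inverse_density h s t))"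

text \<open>The derivative of order \<open>\<nu> \<in> (0,1]\<close> at \<open>t > 0\<close>; the existence of the
  ordinary derivative and of the integral is part of the predicate.\<close>

definition has_caputo_derivative ::
    "real \<Rightarrow> (real \<Rightarrow> real) \<Rightarrow> real \<Rightarrow> real \<Rightarrow> bool" where
  "has_caputo_derivative \<nu> f D t \<longleftrightarrow>
    (if \<nu> = 1 then (f has_real_derivative D) (at t)
     else (\<forall>s\<in>{0<..<t}. f differentiable (at s)) \<and>
       set_integrable lborel {0<..<t} (\<lambda>s. (t - s) powr (- \<nu>) * deriv f s) \<and>
       D = 1 / Gamma (1 - \<nu>) * (LINT s:{0<..<t}|lborel. (t - s) powr (- \<nu>) * deriv f s))"

end

theory Submission
  imports Defs "HOL-Complex_Analysis.Complex_Analysis"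
begin

text \<open>For \<open>\<nu> < 1\<close>, turning the Bromwich contour gives a smooth function \<open>k\<close> whose Laplace transform is
  \<open>\<nu> q\<^bsup>\<nu> - 1\<^esup> exp (- q\<^bsup>\<nu>\<^esup>)\<close> (residue theorem in a strip). Uniqueness of Laplace transforms yields
  \<open>h s y = k (s y\<^bsup>-1/\<nu>\<^esup>) / s\<close>, hence the inverse density at time \<open>t\<close> is \<open>k (t y\<^bsup>-1/\<nu>\<^esup>) / (\<nu> y)\<close>, and with
  \<open>f = h (\<cdot>, 1)\<close> the mixture becomes
  \<open>u = x\<^bsup>\<mu> - 1\<^esup> / \<Gamma>(\<mu>) * V\<^sub>\<mu>\<close>, where
  \<open>V\<^sub>b = \<integral> R\<^sup>b e\<^bsup>-xR\<^esup> f(z) dz\<close> and \<open>R = (z / t)\<^sup>\<nu>\<close>. Here \<open>\<partial>\<^sub>x V\<^sub>b = - V\<^bsub>b + 1\<^esub>\<close> and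
  \<open>\<partial>\<^sub>t V\<^sub>b = - (\<nu> / t) (b V\<^sub>b - x V\<^bsub>b + 1\<^esub>)\<close>. The Abel integral of \<open>(\<nu> / t) V\<^sub>b\<close> is \<open>\<Gamma>(1 - \<nu>) V\<^bsub>b + 1\<^esub>\<close>, because
  \<open>z f(z) = \<nu> / \<Gamma>(1 - \<nu>) \<integral>\<^sub>0\<^sup>z (z - w)\<^bsup>-\<nu>\<^esup> f(w) dw\<close>, again by Laplace uniqueness. Both sides of the equation
  then equal \<open>x\<^bsup>\<mu> - 1\<^esup> / \<Gamma>(\<mu>) * (x V\<^bsub>\<mu> + 2\<^esub> - \<mu> V\<^bsub>\<mu> + 1\<^esub>)\<close>.\<close>

subsection \<open>Differentiation of integrals and uniqueness of Laplace transforms\<close>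

text \<open>The obstacle is that nothing is known about the regularity of \<open>h\<close> in its
  time argument, although \<open>inverse_density\<close> differentiates there: each time slice is
  given by continuity in space and a Laplace transform. A smooth explicit formula must therefore
  come before any derivative. The transform of z f(z) is inverted instead of that of f because s
  h(s, y) depends on the single variable s y^(-1/\<nu>) without a further factor. Its derivatives in
  y and in s are then proportional, the integral defining \<open>inverse_density\<close> becomes
  that of an exact derivative, and the same function z f(z) is one side of the Abel identity. The
  Caputo integrand is singular at both ends, through (t - s)^(-\<nu>) and through \<nu> / s. No
  estimate of V_b near s = 0 is made: the integrands of the Abel step are nonnegative, so Tonelli's
  theorem yields convergence together with the value.\<close>

lemma has_real_derivative_integral:
  fixes K K' :: "real \<Rightarrow> 'a \<Rightarrow> real"
  assumes x0: "x0 \<in> {a<..<b}"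
    and int: "\<And>x. x \<in> {a<..<b} \<Longrightarrow> integrable M (K x)"
    and deriv: "\<And>x z. x \<in> {a<..<b} \<Longrightarrow> z \<in> space M \<Longrightarrow> ((\<lambda>x. K x z) has_real_derivative K' x z) (at x)"
    and bound: "\<And>x z. x \<in> {a<..<b} \<Longrightarrow> z \<in> space M \<Longrightarrow> \<bar>K' x z\<bar> \<le> B z"
    and B: "integrable M B"
  shows "((\<lambda>x. \<integral>z. K x z \<partial>M) has_real_derivative (\<integral>z. K' x0 z \<partial>M)) (at x0)"
    and "integrable M (K' x0)"
proof -
  define Q where "Q = (\<lambda>y z. (K y z - K x0 z) / (y - x0))"
  have Qlim: "((\<lambda>y. Q y z) \<longlongrightarrow> K' x0 z) (at x0)" if "z \<in> space M" for z
    using deriv[OF x0 that] unfolding has_field_derivative_iff Q_def .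
  \<comment> \<open>The mean value inequality turns the bound on the derivatives into one on the
    difference quotients, so \<open>B\<close> dominates the whole family.\<close>
  have Qb: "\<bar>Q y z\<bar> \<le> B z" if y: "y \<in> {a<..<b}" and z: "z \<in> space M" for y z
  proof -
    have "norm (K y z - K x0 z) \<le> B z * norm (y - x0)"
      by (rule field_differentiable_bound[of "{a<..<b}" "\<lambda>x. K x z" "\<lambda>x. K' x z"])
        (use deriv bound x0 y z in \<open>auto intro: has_field_derivative_at_within\<close>)
    moreover have "0 \<le> B z"
      using bound[OF x0 z] by linarith
    ultimately show ?thesis
      unfolding Q_def by (cases "y = x0") (auto simp: field_simps abs_mult)
  qed
  have ev: "eventually (\<lambda>y. y \<in> {a<..<b}) (at x0)"
    using x0 by (intro eventually_at_in_open') auto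
  have Qint: "integrable M (Q y)" if "y \<in> {a<..<b}" for y
    unfolding Q_def using int[OF that] int[OF x0] by auto
  \<comment> \<open>Measurability of the derivative is not assumed; it is a pointwise limit of
    difference quotients along a sequence tending to \<open>x0\<close>.\<close>
  have meas: "K' x0 \<in> borel_measurable M"
  proof -
    obtain X where X: "\<And>n::nat. X n \<in> {a<..<b} - {x0}" "X \<longlonglongrightarrow> x0"
    proof -
      have "x0 islimpt {a<..<b}"
        using x0 by (intro interior_limit_point) auto
      then show ?thesis using that unfolding islimpt_sequential by blast
    qed
    have "filterlim X (at x0) sequentially"
      unfolding filterlim_at using X by auto
    then have *: "(\<lambda>n. Q (X n) z) \<longlonglongrightarrow> K' x0 z" if "z \<in> space M" for z
      using Qlim[OF that] filterlim_compose by blast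
    have "\<And>n. Q (X n) \<in> borel_measurable M"
      using X(1) Qint by blast
    then show ?thesis
      using * by (rule borel_measurable_LIMSEQ_real[rotated])
  qed
  show "integrable M (K' x0)"
    by (rule Bochner_Integration.integrable_bound[OF B meas])
      (use bound[OF x0] in \<open>force intro!: AE_I2\<close>)
  have "((\<lambda>y. \<integral>z. Q y z \<partial>M) \<longlongrightarrow> (\<integral>z. K' x0 z \<partial>M)) (at x0)"
  proof (subst tendsto_at_iff_sequentially, intro allI impI)
    fix X :: "nat \<Rightarrow> real"
    assume X: "\<forall>i. X i \<in> UNIV - {x0}" "X \<longlonglongrightarrow> x0"
    then have f: "filterlim X (at x0) sequentially"
      unfolding filterlim_at by auto
    have "eventually (\<lambda>n. X n \<in> {a<..<b}) sequentially"
      by (rule eventually_compose_filterlim[OF ev f])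
    then obtain N where N: "\<And>n. n \<ge> N \<Longrightarrow> X n \<in> {a<..<b}"
      by (auto simp: eventually_sequentially)
    \<comment> \<open>The sequence lies in the interval only from index \<open>N\<close> on, while
      dominated convergence asks for the bound at every index; hence the shift.\<close>
    have "(\<lambda>n. \<integral>z. Q (X (n + N)) z \<partial>M) \<longlonglongrightarrow> (\<integral>z. K' x0 z \<partial>M)"
    proof (rule integral_dominated_convergence[OF meas _ B])
      show "Q (X (n + N)) \<in> borel_measurable M" for n
        using Qint N by simp
      show "AE z in M. (\<lambda>n. Q (X (n + N)) z) \<longlonglongrightarrow> K' x0 z"
        using filterlim_compose[OF Qlim f] by (auto intro!: AE_I2 LIMSEQ_ignore_initial_segment)
      show "AE z in M. norm (Q (X (n + N)) z) \<le> B z" for n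
        using Qb N by (auto intro!: AE_I2)
    qed
    then show "((\<lambda>y. \<integral>z. Q y z \<partial>M) \<circ> X) \<longlonglongrightarrow> (\<integral>z. K' x0 z \<partial>M)"
      by (simp add: LIMSEQ_offset o_def)
  qed
  moreover have "\<forall>\<^sub>F y in at x0. (\<integral>z. Q y z \<partial>M) = ((\<integral>z. K y z \<partial>M) - (\<integral>z. K x0 z \<partial>M)) / (y - x0)"
    using ev
  proof eventually_elim
    case (elim y)
    show ?case
      unfolding Q_def using Bochner_Integration.integral_diff[OF int[OF elim] int[OF x0]] by simp
  qed
  ultimately show "((\<lambda>x. \<integral>z. K x z \<partial>M) has_real_derivative (\<integral>z. K' x0 z \<partial>M)) (at x0)"
    unfolding has_field_derivative_iff by (rule Lim_transform_eventually)
qed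

text \<open>The inequality u \<le> exp u at u = a r / b, raised to the power b. It is the source of
  the uniform bounds that dominate the integrands below.\<close>

lemma powr_times_exp_le:
  fixes a b r :: real
  assumes "0 < a" "0 < b" "0 \<le> r"
  shows "r powr b * exp (- (a * r)) \<le> (b / a) powr b"
proof -
  have "a * r / b \<le> exp (a * r / b)"
    using exp_ge_add_one_self[of "a * r / b"] by linarith
  then have "(a * r / b) powr b \<le> exp (a * r / b) powr b"
    using assms by (intro powr_mono2) auto
  also have "\<dots> = exp (a * r)"
    using assms by (simp add: powr_def)
  finally have "(b / a) powr b * (a * r / b) powr b \<le> (b / a) powr b * exp (a * r)"
    by (intro mult_left_mono) auto
  moreover have "(b / a) powr b * (a * r / b) powr b = r powr b"
    using assms by (simp flip: powr_mult)
  ultimately show ?thesis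
    by (simp add: exp_minus field_simps)
qed

text \<open>Lerch's theorem. With y = exp (- x), the values at q = n + 1 are moments of a function
  on (0, 1). Weierstrass approximation extends their vanishing to continuous test functions of y,
  and these approximate indicators of half-lines.\<close>

lemma laplace_eq_zero_imp_AE_zero:
  fixes g :: "real \<Rightarrow> real"
  assumes int: "\<And>q. 0 < q \<Longrightarrow> set_integrable lborel {0<..} (\<lambda>x. exp (- q * x) * g x)"
    and zero: "\<And>q. 0 < q \<Longrightarrow> (LINT x:{0<..}|lborel. exp (- q * x) * g x) = 0"
  shows "AE x in lborel. 0 < x \<longrightarrow> g x = 0"
proof -
  \<comment> \<open>One factor exp (- x) is spent on integrability, since \<open>g\<close> itself
    may fail to be integrable; the n-th power of exp (- x) then belongs to q = n + 1.\<close>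
  define G where "G = (\<lambda>x. indicator {0<..} x * (exp (- x) * g x))"
  have Gint: "integrable lborel G"
    using int[of 1] unfolding G_def set_integrable_def by simp
  have [measurable]: "G \<in> borel_measurable borel"
    using Gint by auto
  have pow: "integrable lborel (\<lambda>x. exp (- x) ^ n * G x)" "(\<integral>x. exp (- x) ^ n * G x \<partial>lborel) = 0" for n
  proof -
    have eq: "exp (- x) ^ n * G x = indicator {0<..} x * (exp (- (real (Suc n)) * x) * g x)" for x
      unfolding G_def by (simp add: algebra_simps flip: exp_of_nat_mult exp_add)
    show "integrable lborel (\<lambda>x. exp (- x) ^ n * G x)" "(\<integral>x. exp (- x) ^ n * G x \<partial>lborel) = 0"
      unfolding eq using int[of "real (Suc n)"] zero[of "real (Suc n)"]
      by (simp_all add: set_integrable_def set_lebesgue_integral_def)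
  qed
  have cont: "(\<integral>x. \<phi> (exp (- x)) * G x \<partial>lborel) = 0"
    if \<phi>: "continuous_on UNIV \<phi>" for \<phi> :: "real \<Rightarrow> real"
  proof -
    have \<phi>01: "continuous_on {0..1} \<phi>"
      using \<phi> by (rule continuous_on_subset) simp
    then have "bounded (\<phi> ` {0..1})"
      by (intro compact_imp_bounded compact_continuous_image) auto
    then obtain C where C: "\<And>y. y \<in> {0..1} \<Longrightarrow> \<bar>\<phi> y\<bar> \<le> C"
      unfolding bounded_iff real_norm_def by blast
    have [measurable]: "\<phi> \<in> borel_measurable borel"
      using \<phi> by (rule borel_measurable_continuous_onI)
    have \<phi>int: "integrable lborel (\<lambda>x. \<phi> (exp (- x)) * G x)"
    proof (rule Bochner_Integration.integrable_bound[of _ "\<lambda>x. C * G x"])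
      show "AE x in lborel. norm (\<phi> (exp (- x)) * G x) \<le> norm (C * G x)"
      proof (intro AE_I2)
        fix x :: real
        show "norm (\<phi> (exp (- x)) * G x) \<le> norm (C * G x)"
        proof (cases "x > 0")
          case True
          then have "\<bar>\<phi> (exp (- x))\<bar> \<le> C" by (intro C) auto
          then have "\<bar>\<phi> (exp (- x))\<bar> \<le> \<bar>C\<bar>" by linarith
          then show ?thesis by (simp add: abs_mult mult_right_mono)
        qed (simp add: G_def)
      qed
    qed (use Gint in auto)
    have "\<bar>\<integral>x. \<phi> (exp (- x)) * G x \<partial>lborel\<bar> \<le> e" if e: "0 < e" for e
    proof -
      define I where "I = (\<integral>x. \<bar>G x\<bar> \<partial>lborel)"
      have I: "0 \<le> I" unfolding I_def by simp
      \<comment> \<open>The tolerance is divided by I + 1 because I may be 0.\<close>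
      obtain p where p: "real_polynomial_function p" "\<And>y. y \<in> {0..1} \<Longrightarrow> \<bar>\<phi> y - p y\<bar> < e / (I + 1)"
        using Stone_Weierstrass_real_polynomial_function[OF compact_Icc \<phi>01, of "e / (I + 1)"] e I
        by auto
      obtain c n where pc: "p = (\<lambda>x. \<Sum>i\<le>n. c i * x ^ i)"
        using p(1) real_polynomial_function_iff_sum by auto
      have peq: "p (exp (- x)) * G x = (\<Sum>i\<le>n. c i * (exp (- x) ^ i * G x))" for x
        by (simp add: pc sum_distrib_right mult.assoc)
      have pint: "integrable lborel (\<lambda>x. p (exp (- x)) * G x)" "(\<integral>x. p (exp (- x)) * G x \<partial>lborel) = 0"
        unfolding peq using pow by simp_all
      have "(\<integral>x. \<phi> (exp (- x)) * G x \<partial>lborel) = (\<integral>x. \<phi> (exp (- x)) * G x - p (exp (- x)) * G x \<partial>lborel)"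
        using \<phi>int pint by simp
      also have "\<bar>\<dots>\<bar> \<le> (\<integral>x. e / (I + 1) * \<bar>G x\<bar> \<partial>lborel)"
        unfolding real_norm_def[symmetric]
      proof (rule Bochner_Integration.integral_norm_bound_integral)
        fix x :: real
        show "norm (\<phi> (exp (- x)) * G x - p (exp (- x)) * G x) \<le> e / (I + 1) * norm (G x)"
        proof (cases "x > 0")
          case True
          then have "\<bar>\<phi> (exp (- x)) - p (exp (- x))\<bar> < e / (I + 1)" by (intro p) auto
          then have "\<bar>\<phi> (exp (- x)) - p (exp (- x))\<bar> * \<bar>G x\<bar> \<le> e / (I + 1) * \<bar>G x\<bar>"
            by (intro mult_right_mono) auto
          moreover have "\<phi> (exp (- x)) * G x - p (exp (- x)) * G x = (\<phi> (exp (- x)) - p (exp (- x))) * G x"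
            by (simp add: left_diff_distrib)
          ultimately show ?thesis
            by (simp only: real_norm_def abs_mult)
        qed (simp add: G_def)
      qed (use \<phi>int pint Gint in auto)
      also have "\<dots> = e / (I + 1) * I"
        by (simp add: I_def)
      also have "\<dots> \<le> e"
        using e I by (simp add: field_simps)
      finally show ?thesis .
    qed
    then have "\<bar>\<integral>x. \<phi> (exp (- x)) * G x \<partial>lborel\<bar> \<le> 0"
      by (rule dense_ge)
    then show ?thesis
      by simp
  qed
  have half: "(\<integral>x. indicator {..a} x * G x \<partial>lborel) = 0" for a
  proof -
    define c where "c = exp (- a)"
    \<comment> \<open>A ramp that is 1 from c upwards and 0 below c - 1/n. As exp (- x) \<ge> c
      means x \<le> a, its limit is the indicator of {..a}.\<close>
    define \<phi> where "\<phi> = (\<lambda>n y. max 0 (min 1 (1 + real n * (y - c))))"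
    have "(\<lambda>n. \<integral>x. \<phi> n (exp (- x)) * G x \<partial>lborel) \<longlonglongrightarrow> (\<integral>x. indicator {..a} x * G x \<partial>lborel)"
    proof (rule integral_dominated_convergence[where w = "\<lambda>x. \<bar>G x\<bar>"])
      show "AE x in lborel. (\<lambda>n. \<phi> n (exp (- x)) * G x) \<longlonglongrightarrow> indicator {..a} x * G x"
      proof (intro AE_I2 tendsto_mult tendsto_const)
        fix x :: real
        show "(\<lambda>n. \<phi> n (exp (- x))) \<longlonglongrightarrow> indicator {..a} x"
        proof (cases "x \<le> a")
          case True
          then have "\<phi> n (exp (- x)) = 1" for n
            unfolding \<phi>_def c_def by simp
          then show ?thesis using True by simp
        next
          case False
          then have d: "0 < c - exp (- x)" unfolding c_def by simp
          have "\<forall>\<^sub>F n in sequentially. 1 \<le> real n * (c - exp (- x))"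
            using d by real_asymp
          then have "\<forall>\<^sub>F n in sequentially. \<phi> n (exp (- x)) = 0"
            by eventually_elim (auto simp: \<phi>_def algebra_simps)
          then show ?thesis using False by (simp add: tendsto_eventually)
        qed
      qed
      show "AE x in lborel. norm (\<phi> n (exp (- x)) * G x) \<le> \<bar>G x\<bar>" for n
        by (intro AE_I2) (auto simp: abs_mult \<phi>_def intro!: mult_left_le_one_le)
    qed (use Gint in \<open>auto simp: \<phi>_def\<close>)
    moreover have "(\<integral>x. \<phi> n (exp (- x)) * G x \<partial>lborel) = 0" for n
      unfolding \<phi>_def by (intro cont continuous_intros)
    ultimately show ?thesis
      by (simp add: LIMSEQ_const_iff)
  qed
  let ?P = "density lborel (\<lambda>x. ennreal (max 0 (G x)))"
  let ?N = "density lborel (\<lambda>x. ennreal (max 0 (- G x)))"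
  have em: "emeasure (density lborel (\<lambda>x. ennreal (max 0 (F x)))) {a<..}
      = ennreal (\<integral>x. max 0 (F x) * indicator {a<..} x \<partial>lborel)"
    if "integrable lborel F" for F :: "real \<Rightarrow> real" and a
  proof -
    have [measurable]: "F \<in> borel_measurable borel" using that by auto
    have "emeasure (density lborel (\<lambda>x. ennreal (max 0 (F x)))) {a<..}
        = (\<integral>\<^sup>+x. ennreal (max 0 (F x) * indicator {a<..} x) \<partial>lborel)"
      by (subst emeasure_density) (auto intro!: nn_integral_cong split: split_indicator)
    also have "\<dots> = ennreal (\<integral>x. max 0 (F x) * indicator {a<..} x \<partial>lborel)"
      by (intro nn_integral_eq_integral integrable_real_mult_indicator integrable_max) (use that in auto)
    finally show ?thesis .
  qed
  have Gint': "integrable lborel (\<lambda>x. - G x)"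
    using Gint by simp
  \<comment> \<open>The integral of G vanishes over the whole line and over {..a}, hence over
    {a<..}. So the positive and the negative part give these half-lines equal finite mass, which
    determines the measures.\<close>
  have "?P = ?N"
  proof (rule measure_eqI_lessThan)
    fix a
    have "(\<integral>x. max 0 (G x) * indicator {a<..} x \<partial>lborel) - (\<integral>x. max 0 (- G x) * indicator {a<..} x \<partial>lborel)
        = (\<integral>x. max 0 (G x) * indicator {a<..} x - max 0 (- G x) * indicator {a<..} x \<partial>lborel)"
      by (intro Bochner_Integration.integral_diff[symmetric] integrable_real_mult_indicator integrable_max)
        (use Gint in auto)
    also have "\<dots> = (\<integral>x. G x - indicator {..a} x * G x \<partial>lborel)"
      by (intro Bochner_Integration.integral_cong) (auto split: split_indicator)
    also have "\<dots> = 0"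
      using half[of a] Gint pow[of 0] by (simp add: integrable_real_mult_indicator mult.commute)
    finally show "emeasure ?P {a<..} = emeasure ?N {a<..}"
      unfolding em[OF Gint] em[OF Gint'] by simp
  next
    show "emeasure ?P {a<..} < \<infinity>" for a
      unfolding em[OF Gint] by simp
  qed auto
  then have "AE x in lborel. ennreal (max 0 (G x)) = ennreal (max 0 (- G x))"
    by (subst (asm) sigma_finite_measure.density_unique_iff[OF lborel.sigma_finite_measure_axioms]) auto
  then show ?thesis
  proof eventually_elim
    case (elim x)
    then have "max 0 (G x) = max 0 (- G x)"
      by (subst (asm) ennreal_inj) auto
    then have "G x = 0" by (auto simp: max_def split: if_splits)
    then show ?case by (auto simp: G_def)
  qed
qed

text \<open>The set where \<open>F\<close> does not vanish is open and null, hence empty. This turns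
  the almost everywhere conclusion of Laplace uniqueness into a pointwise formula, as is required
  before differentiating.\<close>

lemma AE_zero_continuous_on_Ioi:
  fixes F :: "real \<Rightarrow> real"
  assumes cont: "continuous_on {0<..} F" and AE: "AE x in lborel. 0 < x \<longrightarrow> F x = 0" and x: "0 < x"
  shows "F x = 0"
proof (rule ccontr)
  assume "F x \<noteq> 0"
  define U where "U = {0<..} \<inter> F -` (- {0})"
  have "open U"
    unfolding U_def using cont by (intro continuous_open_preimage) auto
  moreover have "x \<in> U"
    using x \<open>F x \<noteq> 0\<close> by (simp add: U_def)
  moreover have "negligible U"
  proof -
    have "{y \<in> space lborel. \<not> (0 < y \<longrightarrow> F y = 0)} = U"
      by (auto simp: U_def)
    then have "U \<in> null_sets lborel"
      using AE \<open>open U\<close> by (subst (asm) AE_iff_null) auto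
    then show ?thesis
      by (simp add: negligible_iff_null_sets null_sets_completionI)
  qed
  ultimately show False
    using open_not_negligible by blast
qed

subsection \<open>Residues in a strip\<close>

lemma contour_integral_horizontal_linepath:
  fixes f :: "complex \<Rightarrow> complex"
  assumes "a < b" and cont: "continuous_on {a..b} (\<lambda>y. f (Complex y c))"
  shows "contour_integral (linepath (Complex a c) (Complex b c)) f
    = (LINT y:{a..b}|lborel. f (Complex y c))"
proof -
  have "linepath (Complex a c) (Complex b c) = (+) (Complex 0 c) \<circ> linepath (complex_of_real a) (complex_of_real b)"
    by (auto simp: linepath_def fun_eq_iff complex_eq_iff algebra_simps)
  then have "contour_integral (linepath (Complex a c) (Complex b c)) f
      = contour_integral (linepath (complex_of_real a) (complex_of_real b)) (\<lambda>x. f (x + Complex 0 c))"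
    by (simp add: contour_integral_translate)
  also have "\<dots> = integral {a..b} (\<lambda>x. f (of_real x + Complex 0 c))"
    using assms(1) by (subst contour_integral_linepath_Reals_eq) auto
  also have "(\<lambda>x. f (of_real x + Complex 0 c)) = (\<lambda>y. f (Complex y c))"
    by (simp add: complex_of_real_def plus_complex.ctr)
  also have "integral {a..b} (\<lambda>y. f (Complex y c)) = (LINT y:{a..b}|lborel. f (Complex y c))"
    by (rule set_borel_integral_eq_integral(2)[symmetric]) (rule borel_integrable_atLeastAtMost'[OF cont])
  finally show ?thesis .
qed

text \<open>Residue theorem on the rectangle of half-width R and half-height c. Counterclockwise,
  the bottom runs to the right and the top to the left, which fixes the order of the difference. The
  vertical sides keep their length while the integrand on them is at most \<open>B R\<close>, so
  they vanish in the limit.\<close>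

lemma residue_strip:
  fixes f :: "complex \<Rightarrow> complex" and p r :: complex and c d :: real
  assumes cd: "0 < c" "c < d" and p: "\<bar>Im p\<bar> < c"
    and holo: "f holomorphic_on {z. \<bar>Im z\<bar> < d} - {p}"
    and lim: "((\<lambda>w. f w * (w - p)) \<longlongrightarrow> r) (at p)"
    and int: "integrable lborel (\<lambda>y. f (Complex y c))" "integrable lborel (\<lambda>y. f (Complex y (- c)))"
    and bound: "\<And>R v. R0 \<le> R \<Longrightarrow> \<bar>v\<bar> \<le> c \<Longrightarrow> norm (f (Complex R v)) \<le> B R"
      "\<And>R v. R0 \<le> R \<Longrightarrow> \<bar>v\<bar> \<le> c \<Longrightarrow> norm (f (Complex (- R) v)) \<le> B R"
    and B: "(B \<longlongrightarrow> 0) at_top"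
  shows "(\<integral>y. f (Complex y (- c)) \<partial>lborel) - (\<integral>y. f (Complex y c) \<partial>lborel) = 2 * of_real pi * \<i> * r"
proof -
  define S where "S = {z. \<bar>Im z\<bar> < d}"
  have S: "S = {z. Im z < d} \<inter> {z. Im z > - d}"
    unfolding S_def by auto
  have "open S" "convex S"
    unfolding S by (auto intro!: open_Int convex_Int open_halfspace_Im_lt open_halfspace_Im_gt
        convex_halfspace_Im_lt convex_halfspace_Im_gt)
  then have "connected S"
    by (simp add: convex_connected)
  have pS: "p \<in> S"
    using p cd by (simp add: S_def)
  note holo = holo[folded S_def]
  have cf: "continuous_on (S - {p}) f"
    using holo by (rule holomorphic_on_imp_continuous_on)
  have res: "residue f p = r"
    using \<open>open S\<close> pS holo lim by (rule residue_simple')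
  define J where "J = (\<lambda>R v. LINT y:{-R..R}|lborel. f (Complex y v))"
  have Jlim: "((\<lambda>R. J R v) \<longlongrightarrow> (\<integral>y. f (Complex y v) \<partial>lborel)) at_top"
    if v: "integrable lborel (\<lambda>y. f (Complex y v))" for v
    unfolding J_def set_lebesgue_integral_def
  proof (rule integral_dominated_convergence_at_top[where w = "\<lambda>y. norm (f (Complex y v))"])
    show "AE y in lborel. ((\<lambda>R. indicator {-R..R} y *\<^sub>R f (Complex y v)) \<longlongrightarrow> f (Complex y v)) at_top"
    proof (intro AE_I2 tendsto_eventually)
      fix y :: real
      show "\<forall>\<^sub>F R in at_top. indicator {-R..R} y *\<^sub>R f (Complex y v) = f (Complex y v)"
        using eventually_ge_at_top[of "\<bar>y\<bar>"] by eventually_elim (auto simp: indicator_def)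
    qed
  qed (use v in \<open>auto intro!: always_eventually AE_I2 split: split_indicator\<close>)
  \<comment> \<open>The constant 4 c is the joint length of the two vertical sides.\<close>
  have main: "norm (J R (- c) - J R c - 2 * of_real pi * \<i> * r) \<le> 4 * c * B R"
    if R: "R0 \<le> R" "\<bar>Re p\<bar> < R" for R
  proof -
    define a1 a2 a3 a4 where "a1 = Complex (- R) (- c)" and "a2 = Complex R (- c)"
      and "a3 = Complex R c" and "a4 = Complex (- R) c"
    have rect: "rectpath a1 a3 = linepath a1 a2 +++ linepath a2 a3 +++ linepath a3 a4 +++ linepath a4 a1"
      by (simp add: rectpath_def Let_def a1_def a2_def a3_def a4_def)
    have Rpos: "0 < R" using R by linarith
    have img: "path_image (rectpath a1 a3) \<subseteq> S - {p}"
      using p R cd by (subst path_image_rectpath) (auto simp: a1_def a3_def S_def)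
    then have segs: "closed_segment a1 a2 \<subseteq> S - {p}" "closed_segment a2 a3 \<subseteq> S - {p}"
        "closed_segment a3 a4 \<subseteq> S - {p}" "closed_segment a4 a1 \<subseteq> S - {p}"
      unfolding rect by (auto simp: path_image_join)
    then have ci: "f contour_integrable_on linepath a1 a2" "f contour_integrable_on linepath a2 a3"
        "f contour_integrable_on linepath a3 a4" "f contour_integrable_on linepath a4 a1"
      by (auto intro!: contour_integrable_continuous_linepath continuous_on_subset[OF cf])
    have cint: "contour_integral (rectpath a1 a3) f
        = 2 * pi * \<i> * (\<Sum>q\<in>{p}. winding_number (rectpath a1 a3) q * residue f q)"
    proof (rule Residue_theorem[OF \<open>open S\<close> \<open>connected S\<close> _ holo _ _ img])
      show "\<forall>z. z \<notin> S \<longrightarrow> winding_number (rectpath a1 a3) z = 0"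
        using img by (auto intro!: winding_number_zero_outside[OF _ \<open>convex S\<close>])
    qed auto
    have wn: "winding_number (rectpath a1 a3) p = 1"
      using p R by (intro winding_number_rectpath) (auto simp: in_box_complex_iff a1_def a3_def)
    have "contour_integral (linepath a1 a2) f + contour_integral (linepath a2 a3) f
        + contour_integral (linepath a3 a4) f + contour_integral (linepath a4 a1) f = 2 * of_real pi * \<i> * r"
      using cint ci unfolding rect by (simp add: res wn[unfolded rect] add.assoc)
    moreover have "contour_integral (linepath a1 a2) f = J R (- c)"
      unfolding J_def a1_def a2_def using Rpos
    proof (intro contour_integral_horizontal_linepath continuous_on_compose2[OF cf])
      show "(\<lambda>y. Complex y (- c)) ` {-R..R} \<subseteq> S - {p}"
        using p cd by (auto simp: S_def complex_eq_iff)
    qed (auto intro!: continuous_intros)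
    moreover have "contour_integral (linepath a3 a4) f = - contour_integral (linepath a4 a3) f"
      using segs by (intro contour_integral_reverse_linepath continuous_on_subset[OF cf])
        (auto simp: closed_segment_commute)
    moreover have "contour_integral (linepath a4 a3) f = J R c"
      unfolding J_def a3_def a4_def using Rpos
    proof (intro contour_integral_horizontal_linepath continuous_on_compose2[OF cf])
      show "(\<lambda>y. Complex y c) ` {-R..R} \<subseteq> S - {p}"
        using p cd by (auto simp: S_def complex_eq_iff)
    qed (auto intro!: continuous_intros)
    moreover have BR: "0 \<le> B R"
      using bound(1)[of R 0] cd R order_trans[OF norm_ge_zero] by auto
    have "norm (contour_integral (linepath a2 a3) f) \<le> B R * norm (a3 - a2)"
    proof (rule contour_integral_bound_linepath[OF ci(2) BR])
      fix z assume "z \<in> closed_segment a2 a3"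
      then have "Re z = R" "\<bar>Im z\<bar> \<le> c"
        using cd by (auto simp: a2_def a3_def closed_segment_same_Re closed_segment_eq_real_ivl)
      then show "norm (f z) \<le> B R"
        using bound(1)[of R "Im z"] R by (metis complex.collapse)
    qed
    moreover have "norm (contour_integral (linepath a4 a1) f) \<le> B R * norm (a1 - a4)"
    proof (rule contour_integral_bound_linepath[OF ci(4) BR])
      fix z assume "z \<in> closed_segment a4 a1"
      then have "Re z = - R" "\<bar>Im z\<bar> \<le> c"
        using cd by (auto simp: a4_def a1_def closed_segment_same_Re closed_segment_eq_real_ivl)
      then show "norm (f z) \<le> B R"
        using bound(2)[of R "Im z"] R by (metis complex.collapse)
    qed
    moreover have "norm (a3 - a2) = 2 * c" "norm (a1 - a4) = 2 * c"
      using cd by (simp_all add: a1_def a2_def a3_def a4_def cmod_eq_Im)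
    ultimately have eq: "J R (- c) - J R c - 2 * of_real pi * \<i> * r
        = - (contour_integral (linepath a2 a3) f + contour_integral (linepath a4 a1) f)"
      and b: "norm (contour_integral (linepath a2 a3) f) \<le> 2 * c * B R"
        "norm (contour_integral (linepath a4 a1) f) \<le> 2 * c * B R"
      by (auto simp: algebra_simps)
    show ?thesis
      unfolding eq norm_minus_cancel using norm_triangle_le[OF add_mono[OF b]] by simp
  qed
  have "((\<lambda>R. J R (- c) - J R c - 2 * of_real pi * \<i> * r) \<longlongrightarrow> 0) at_top"
  proof (rule Lim_null_comparison)
    show "\<forall>\<^sub>F R in at_top. norm (J R (- c) - J R c - 2 * of_real pi * \<i> * r) \<le> 4 * c * B R"
      using eventually_ge_at_top[of R0] eventually_gt_at_top[of "\<bar>Re p\<bar>"]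
      by eventually_elim (rule main)
    show "((\<lambda>R. 4 * c * B R) \<longlongrightarrow> 0) at_top"
      using tendsto_mult_right_zero[OF B] by simp
  qed
  moreover have "((\<lambda>R. J R (- c) - J R c - 2 * of_real pi * \<i> * r) \<longlongrightarrow>
      (\<integral>y. f (Complex y (- c)) \<partial>lborel) - (\<integral>y. f (Complex y c) \<partial>lborel) - 2 * of_real pi * \<i> * r) at_top"
    by (intro tendsto_intros Jlim int)
  ultimately show ?thesis
    using tendsto_unique[OF trivial_limit_at_top_linorder] by fastforce
qed

lemma set_integral_cexp_Ioi:
  fixes c :: complex
  assumes "0 < Re c"
  shows "set_integrable lborel {0<..} (\<lambda>x. exp (- (of_real x * c)))"
    and "(LINT x:{0<..}|lborel. exp (- (of_real x * c))) = 1 / c"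
proof -
  have c: "c \<noteq> 0" using assms by auto
  show int: "set_integrable lborel {0<..} (\<lambda>x. exp (- (of_real x * c)))"
  proof -
    have "set_integrable lborel (einterval 0 \<infinity>) (\<lambda>x. exp (- (x * Re c)))"
    proof (rule interval_integral_FTC_nonneg(1)[where F = "\<lambda>x. - exp (- (x * Re c)) / Re c" and A = "- 1 / Re c" and B = 0])
      show "(((\<lambda>x. - exp (- (x * Re c)) / Re c) \<circ> real_of_ereal) \<longlongrightarrow> - 1 / Re c) (at_right 0)"
        unfolding zero_ereal_def ereal_tendsto_simps1 using assms
        by (auto intro!: tendsto_eq_intros)
      show "(((\<lambda>x. - exp (- (x * Re c)) / Re c) \<circ> real_of_ereal) \<longlongrightarrow> 0) (at_left \<infinity>)"
        unfolding ereal_tendsto_simps1 using assms by real_asymp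
    qed (use assms in \<open>auto intro!: derivative_eq_intros\<close>)
    then have *: "set_integrable lborel {0<..} (\<lambda>x. exp (- (x * Re c)))"
      by (simp add: einterval_def zero_ereal_def greaterThan_def)
    show ?thesis
      by (rule set_integrable_bound[OF *]) (auto simp: set_borel_measurable_def)
  qed
  have "(LBINT x=0..\<infinity>. exp (- (of_real x * c))) = 0 - (- 1 / c)"
  proof (rule interval_integral_FTC_integrable[where F = "\<lambda>x. - exp (- (of_real x * c)) / c"])
    show "((\<lambda>x. - exp (- (of_real x * c)) / c) has_vector_derivative exp (- (of_real x * c))) (at x)" for x
      using c by (auto intro!: derivative_eq_intros has_vector_derivative_real_field)
    show "(((\<lambda>x. - exp (- (of_real x * c)) / c) \<circ> real_of_ereal) \<longlongrightarrow> - 1 / c) (at_right 0)"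
      unfolding zero_ereal_def ereal_tendsto_simps1 using c by (auto intro!: tendsto_eq_intros)
    have "((\<lambda>x. exp (- (x * Re c)) / norm c) \<longlongrightarrow> 0) at_top"
      using assms c by real_asymp
    then have "((\<lambda>x. - exp (- (of_real x * c)) / c) \<longlongrightarrow> 0) at_top"
      by (rule Lim_null_comparison[rotated]) (simp add: norm_divide)
    then show "(((\<lambda>x. - exp (- (of_real x * c)) / c) \<circ> real_of_ereal) \<longlongrightarrow> 0) (at_left \<infinity>)"
      unfolding ereal_tendsto_simps1 .
    show "set_integrable lborel (einterval 0 \<infinity>) (\<lambda>x. exp (- (of_real x * c)))"
      using int by (simp add: einterval_def zero_ereal_def greaterThan_def)
  qed (auto intro!: continuous_intros)
  then show "(LINT x:{0<..}|lborel. exp (- (of_real x * c))) = 1 / c"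
    by (simp add: interval_lebesgue_integral_def einterval_def zero_ereal_def greaterThan_def)
qed

text \<open>The majorant is C exp (- \<alpha> |y|). For y \<le> 0 the inner exponential is simply
  dropped. For y > 0, write exp (\<alpha> y) = exp (2 \<alpha> y) exp (- \<alpha> y); the first
  factor is the power 2 \<alpha> / \<beta> of exp (\<beta> y), and \<open>powr_times_exp_le\<close>
  bounds it against the double exponential.\<close>

lemma integrable_exp_minus_exp:
  fixes \<alpha> \<beta> c :: real
  assumes "0 < \<alpha>" "0 < \<beta>" "0 < c"
  shows "integrable lborel (\<lambda>y. exp (\<alpha> * y - c * exp (\<beta> * y)))"
proof -
  define C where "C = max 1 (((2 * \<alpha> / \<beta>) / c) powr (2 * \<alpha> / \<beta>))"
  have "(\<integral>\<^sup>+y. ennreal (exp (- \<alpha> * y)) * indicator {0..} y \<partial>lborel) = ennreal (0 - (- exp (- \<alpha> * 0) / \<alpha>))"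
    by (rule nn_integral_FTC_atLeast[where F = "\<lambda>y. - exp (- \<alpha> * y) / \<alpha>"])
      (use assms in \<open>auto intro!: derivative_eq_intros, real_asymp\<close>)
  then have "integrable lborel (\<lambda>y. exp (- \<alpha> * y) * indicator {0..} y)"
    by (intro integrableI_nonneg) (auto simp: nn_integral_set_ennreal)
  then have "has_bochner_integral lborel (\<lambda>y. indicator {0..} y *\<^sub>R exp (- \<alpha> * \<bar>y\<bar>)) (\<integral>y. exp (- \<alpha> * y) * indicator {0..} y \<partial>lborel)"
    by (subst has_bochner_integral_cong[OF refl _ refl, of _ _ "\<lambda>y. exp (- \<alpha> * y) * indicator {0..} y"])
      (auto simp: has_bochner_integral_integrable split: split_indicator)
  from has_bochner_integral_even_function[OF this] have "integrable lborel (\<lambda>y. exp (- \<alpha> * \<bar>y\<bar>))"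
    by (auto simp: has_bochner_integral_iff)
  then have "integrable lborel (\<lambda>y. C * exp (- \<alpha> * \<bar>y\<bar>))"
    by simp
  then show ?thesis
  proof (rule Bochner_Integration.integrable_bound)
    show "AE y in lborel. norm (exp (\<alpha> * y - c * exp (\<beta> * y))) \<le> norm (C * exp (- \<alpha> * \<bar>y\<bar>))"
    proof (intro AE_I2)
      fix y :: real
      have "exp (\<alpha> * y - c * exp (\<beta> * y)) \<le> C * exp (- \<alpha> * \<bar>y\<bar>)"
      proof (cases "y \<le> 0")
        case True
        have "exp (\<alpha> * y - c * exp (\<beta> * y)) \<le> 1 * exp (- \<alpha> * \<bar>y\<bar>)"
          using True assms by simp
        also have "\<dots> \<le> C * exp (- \<alpha> * \<bar>y\<bar>)"
          by (intro mult_right_mono) (auto simp: C_def)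
        finally show ?thesis .
      next
        case False
        have "exp (\<alpha> * y - c * exp (\<beta> * y))
            = exp (\<beta> * y) powr (2 * \<alpha> / \<beta>) * exp (- (c * exp (\<beta> * y))) * exp (- \<alpha> * \<bar>y\<bar>)"
          using False assms by (simp add: powr_def flip: exp_add)
        also have "\<dots> \<le> C * exp (- \<alpha> * \<bar>y\<bar>)"
          using powr_times_exp_le[of c "2 * \<alpha> / \<beta>" "exp (\<beta> * y)"] assms
          by (intro mult_right_mono) (auto simp: C_def)
        finally show ?thesis .
      qed
      then show "norm (exp (\<alpha> * y - c * exp (\<beta> * y))) \<le> norm (C * exp (- \<alpha> * \<bar>y\<bar>))"
        by simp
    qed
  qed auto
qed

subsection \<open>The stable density as a contour integral\<close>

locale stable_index =
  fixes \<nu> :: real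
  assumes \<nu>: "0 < \<nu>" "\<nu> < 1"
begin

text \<open>With \<open>angle = \<pi> / (1 + \<nu>)\<close> one has \<open>angle + \<nu> * angle = \<pi>\<close>, so that \<open>e\<^bsup>zx\<^esup>\<close> and
  \<open>e\<^bsup>-z\<^sup>\<nu>\<^esup>\<close> decay at the same rate \<open>damp\<close> along the ray \<open>arg z = angle\<close>. The integral \<open>kern 0 x\<close> is
  \<open>x\<close> times the Bromwich integral of \<open>e\<^bsup>-z\<^sup>\<nu>\<^esup>\<close> after one integration by parts, with the
  contour turned to this ray; the substitution \<open>z = e\<^sup>\<zeta>\<close> makes the integrand entire.\<close>

definition angle :: real where "angle = pi / (1 + \<nu>)"

definition damp :: real where "damp = cos (\<nu> * angle)"

definition wave :: "nat \<Rightarrow> real \<Rightarrow> real \<Rightarrow> complex" where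
  "wave n x y = exp ((of_real \<nu> + of_nat n) * Complex y angle + of_real x * exp (Complex y angle)
    - exp (of_real \<nu> * Complex y angle))"

definition kern :: "nat \<Rightarrow> real \<Rightarrow> real" where
  "kern n x = \<nu> / pi * (\<integral>y. Im (wave n x y) \<partial>lborel)"

lemma angle: "0 < angle" "angle < pi" "\<nu> * angle < pi / 2"
proof -
  show "0 < angle" "angle < pi"
    using \<nu> pi_gt_zero by (auto simp: angle_def field_simps)
  have "\<nu> * 2 * pi < (1 + \<nu>) * pi"
    using \<nu> pi_gt_zero by (intro mult_strict_right_mono) auto
  then show "\<nu> * angle < pi / 2"
    using \<nu> by (auto simp: angle_def field_simps)
qed

lemma damp_pos: "0 < damp"
  unfolding damp_def using angle \<nu> by (intro cos_gt_zero_pi) (auto simp: less_eq_real_def intro: le_less_trans[of _ 0])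

lemma cos_angle: "cos angle = - damp"
proof -
  have "angle = pi - \<nu> * angle"
    using \<nu> by (simp add: angle_def field_simps)
  then show ?thesis
    unfolding damp_def by (metis cos_pi_minus)
qed

lemma norm_wave: "norm (wave n x y) = exp ((\<nu> + n) * y - damp * x * exp y - damp * exp (\<nu> * y))"
proof -
  have "Re (exp (of_real \<nu> * Complex y angle)) = damp * exp (\<nu> * y)"
    by (simp add: Re_exp damp_def)
  moreover have "Re (exp (Complex y angle)) = - damp * exp y"
    by (simp add: Re_exp cos_angle)
  ultimately show ?thesis
    unfolding wave_def norm_exp_eq_Re by (simp add: algebra_simps)
qed

text \<open>The damping by e^(-z^\<nu>) is discarded and that by e^(zx) kept. The bound is uniform
  for x \<ge> x0, hence usable for differentiation in x, and integrable in y once x0 > 0.\<close>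

lemma wave_bound:
  assumes "x0 \<le> x"
  shows "\<bar>Im (wave n x y)\<bar> \<le> exp ((\<nu> + n) * y - damp * x0 * exp y)"
proof -
  have "damp * x0 * exp y \<le> damp * x * exp y"
    using assms damp_pos by (intro mult_right_mono mult_left_mono) auto
  moreover have "0 \<le> damp * exp (\<nu> * y)"
    using damp_pos by simp
  ultimately have "norm (wave n x y) \<le> exp ((\<nu> + n) * y - damp * x0 * exp y)"
    unfolding norm_wave by simp
  then show ?thesis
    using abs_Im_le_cmod order_trans by blast
qed

lemma continuous_on_wave: "continuous_on UNIV (\<lambda>(x, y). wave n x y)"
  unfolding wave_def case_prod_unfold
  by (intro continuous_intros)

lemma wave_measurable [measurable]: "(\<lambda>y. Im (wave n x y)) \<in> borel_measurable borel"
  unfolding wave_def by (intro borel_measurable_continuous_onI continuous_intros)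

lemma integrable_bound_wave:
  assumes "0 < x0"
  shows "integrable lborel (\<lambda>y. exp ((\<nu> + real n) * y - damp * x0 * exp y))"
  using integrable_exp_minus_exp[of "\<nu> + real n" 1 "damp * x0"] assms damp_pos \<nu> by simp

lemma integrable_wave:
  assumes "0 < x"
  shows "integrable lborel (\<lambda>y. Im (wave n x y))"
  by (rule Bochner_Integration.integrable_bound[OF integrable_bound_wave[OF assms, of n]])
    (use wave_bound[of x x n] in auto)

text \<open>Differentiating e^(zx) brings down z = e^\<zeta>, which raises the index of
  \<open>wave\<close> by one. The interval from x / 2 to 2 x keeps the parameter away from 0, where
  the majorant would be lost.\<close>

lemma kern_has_derivative:
  assumes "0 < x"
  shows "(kern n has_real_derivative kern (Suc n) x) (at x)"
  unfolding kern_def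
proof (intro DERIV_cmult has_real_derivative_integral(1)[where a = "x / 2" and b = "2 * x"])
  show "((\<lambda>x. Im (wave n x y)) has_real_derivative Im (wave (Suc n) x y)) (at x)" for x y
  proof -
    have "((\<lambda>x. wave n x y) has_vector_derivative exp (Complex y angle) * wave n x y) (at x)"
      unfolding wave_def by (auto intro!: derivative_eq_intros has_vector_derivative_real_field)
    moreover have "exp (Complex y angle) * wave n x y = wave (Suc n) x y"
      unfolding wave_def by (simp add: algebra_simps flip: exp_add)
    ultimately show ?thesis
      unfolding has_real_derivative_iff_has_vector_derivative
      using bounded_linear.has_vector_derivative[OF bounded_linear_Im] by metis
  qed
  show "\<bar>Im (wave (Suc n) z y)\<bar> \<le> exp ((\<nu> + real (Suc n)) * y - damp * (x / 2) * exp y)"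
    if "z \<in> {x / 2<..<2 * x}" for z y
    using that by (intro wave_bound) auto
  show "integrable lborel (\<lambda>y. exp ((\<nu> + real (Suc n)) * y - damp * (x / 2) * exp y))"
    using assms by (intro integrable_bound_wave) auto
qed (use assms in \<open>auto intro: integrable_wave\<close>)

lemma kern_isCont: "0 < x \<Longrightarrow> isCont (kern n) x"
  using kern_has_derivative DERIV_isCont by blast

definition decay :: "nat \<Rightarrow> real" where
  "decay n = \<nu> / pi * (\<integral>y. exp ((\<nu> + real n) * y - damp * exp y) \<partial>lborel)"

text \<open>The shift of y by - ln x is the scaling of z by 1 / x and extracts the power of x. For
  index 1 the decay makes the tail integral in \<open>inverse_density\<close> converge; for index 0
  it kills the boundary term at infinity.\<close>

lemma kern_bound:
  assumes x: "0 < x"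
  shows "\<bar>kern n x\<bar> \<le> decay n * x powr (- (\<nu> + real n))"
proof -
  have "\<bar>\<integral>y. Im (wave n x y) \<partial>lborel\<bar> \<le> (\<integral>y. exp ((\<nu> + n) * y - damp * x * exp y) \<partial>lborel)"
    unfolding real_norm_def[symmetric]
    by (intro Bochner_Integration.integral_norm_bound_integral integrable_wave integrable_bound_wave x)
      (use wave_bound[of x x n] in auto)
  also have "\<dots> = (\<integral>y. exp ((\<nu> + n) * (- ln x + 1 * y) - damp * x * exp (- ln x + 1 * y)) \<partial>lborel)"
    using lborel_integral_real_affine[of 1 "\<lambda>y. exp ((\<nu> + n) * y - damp * x * exp y)" "- ln x"] by simp
  also have "\<dots> = (\<integral>y. x powr (- (\<nu> + real n)) * exp ((\<nu> + real n) * y - damp * exp y) \<partial>lborel)"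
  proof (intro Bochner_Integration.integral_cong refl)
    fix y
    have "exp (- ln x + 1 * y) = exp y / x"
      using x by (simp add: exp_diff)
    then show "exp ((\<nu> + n) * (- ln x + 1 * y) - damp * x * exp (- ln x + 1 * y))
        = x powr (- (\<nu> + real n)) * exp ((\<nu> + real n) * y - damp * exp y)"
      using x by (simp add: powr_def algebra_simps flip: exp_add)
  qed
  finally show ?thesis
    using \<nu> by (simp add: kern_def decay_def abs_mult field_simps)
qed

text \<open>This is what remains of \<open>wave 0 x\<close> after integration against exp (- q x)
  over x > 0, with the height of the line left free: in z = e^\<zeta> it reads z^\<nu> e^(-z^\<nu>)
  / (q - z), with a simple pole at \<zeta> = ln q.\<close>

definition resolvent :: "real \<Rightarrow> complex \<Rightarrow> complex" where
  "resolvent q \<zeta> = exp (of_real \<nu> * \<zeta> - exp (of_real \<nu> * \<zeta>)) / (of_real q - exp \<zeta>)"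

lemma resolvent_cnj: "resolvent q (cnj \<zeta>) = cnj (resolvent q \<zeta>)"
  unfolding resolvent_def by (simp add: exp_cnj)

lemma norm_resolvent:
  "norm (resolvent q (Complex y v)) = exp (\<nu> * y - cos (\<nu> * v) * exp (\<nu> * y)) / norm (of_real q - exp (Complex y v))"
  unfolding resolvent_def norm_divide norm_exp_eq_Re by (simp add: Re_exp mult.commute)

lemma norm_denominator_ge:
  assumes "0 < q"
  shows "q \<le> norm (of_real q - exp (Complex y angle))"
proof -
  have "q \<le> Re (of_real q - exp (Complex y angle))"
    using damp_pos by (simp add: Re_exp cos_angle)
  then show ?thesis
    using complex_Re_le_cmod order_trans by blast
qed

lemma integrable_resolvent:
  assumes q: "0 < q"
  shows "integrable lborel (\<lambda>y. resolvent q (Complex y angle))"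
proof (rule Bochner_Integration.integrable_bound)
  show "integrable lborel (\<lambda>y. exp (\<nu> * y - damp * exp (\<nu> * y)) / q)"
    using integrable_exp_minus_exp[of \<nu> \<nu> damp] damp_pos \<nu> by simp
  have nz: "of_real q - exp (Complex y angle) \<noteq> 0" for y
    using norm_denominator_ge[OF q, of y] q by auto
  then have "(\<lambda>y. resolvent q (Complex y angle)) \<in> borel_measurable borel"
    unfolding resolvent_def by (intro borel_measurable_continuous_onI continuous_intros) auto
  then show "(\<lambda>y. resolvent q (Complex y angle)) \<in> borel_measurable lborel"
    by simp
  show "AE y in lborel. norm (resolvent q (Complex y angle)) \<le> norm (exp (\<nu> * y - damp * exp (\<nu> * y)) / q)"
  proof (intro AE_I2)
    fix y
    have "norm (resolvent q (Complex y angle)) \<le> exp (\<nu> * y - damp * exp (\<nu> * y)) / q"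
      unfolding norm_resolvent damp_def using norm_denominator_ge[OF q, of y] q nz[of y]
      by (intro divide_left_mono) auto
    then show "norm (resolvent q (Complex y angle)) \<le> norm (exp (\<nu> * y - damp * exp (\<nu> * y)) / q)"
      by (rule order_trans) (use q in simp)
  qed
qed

text \<open>The lines at heights \<open>angle\<close> and \<open>- angle\<close> enclose the pole ln
  q, and the integrals over them are complex conjugates. Their difference is thus -2 i Im T, and the
  residue theorem gives Im T alone.\<close>

lemma Im_integral_resolvent:
  assumes q: "0 < q"
  shows "Im (\<integral>y. resolvent q (Complex y angle) \<partial>lborel) = pi * q powr (\<nu> - 1) * exp (- (q powr \<nu>))"
proof -
  \<comment> \<open>The residue at ln q: the numerator is q^\<nu> exp (- q^\<nu>) there, and q -
    e^\<zeta> has derivative - q.\<close>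
  define r where "r = - (q powr (\<nu> - 1) * exp (- (q powr \<nu>)))"
  define T where "T = (\<integral>y. resolvent q (Complex y angle) \<partial>lborel)"
  \<comment> \<open>To the right, exp R \<ge> q + 1 keeps the denominator at least 1; to the left,
    exp (- R) \<le> q / 2 keeps it at least q / 2. \<open>B\<close> adds the bounds for the two
    sides.\<close>
  define R0 where "R0 = max (ln (q + 1)) (- ln (q / 2))"
  define B where "B = (\<lambda>R. exp (\<nu> * R - damp * exp (\<nu> * R)) + 2 / q * exp (- \<nu> * R))"
  have cosv: "damp \<le> cos (\<nu> * v)" if "\<bar>v\<bar> \<le> angle" for v
  proof -
    have "cos (\<nu> * angle) \<le> cos \<bar>\<nu> * v\<bar>"
      using that \<nu> angle by (intro cos_monotone_0_pi_le) (auto simp: abs_mult)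
    then show ?thesis
      by (simp add: damp_def)
  qed
  have "(\<integral>y. resolvent q (Complex y (- angle)) \<partial>lborel) - (\<integral>y. resolvent q (Complex y angle) \<partial>lborel)
      = 2 * of_real pi * \<i> * of_real r"
  \<comment> \<open>The half-height pi is the largest on which exp is injective, so ln q is the only
    zero of the denominator in the open strip; \<open>angle\<close> < pi leaves room inside
    it.\<close>
  proof (rule residue_strip[where d = pi and p = "of_real (ln q)" and B = B and ?R0.0 = R0])
    show "resolvent q holomorphic_on {z. \<bar>Im z\<bar> < pi} - {complex_of_real (ln q)}"
      unfolding resolvent_def
    proof (intro holomorphic_intros)
      fix z assume z: "z \<in> {z. \<bar>Im z\<bar> < pi} - {complex_of_real (ln q)}"
      show "complex_of_real q - exp z \<noteq> 0"
      proof
        assume "complex_of_real q - exp z = 0"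
        then have "Ln (exp z) = Ln (of_real q)" by simp
        moreover have "Ln (exp z) = z"
          using z by (intro Ln_exp) auto
        ultimately show False
          using z q by (simp add: Ln_of_real)
      qed
    qed
    have "((\<lambda>w. (exp w - exp (of_real (ln q))) / (w - of_real (ln q))) \<longlongrightarrow> exp (complex_of_real (ln q))) (at (of_real (ln q)))"
      using DERIV_exp[of "complex_of_real (ln q)"] unfolding has_field_derivative_iff .
    then have *: "((\<lambda>w. (exp w - of_real q) / (w - of_real (ln q))) \<longlongrightarrow> of_real q) (at (complex_of_real (ln q)))"
      using q by (simp add: exp_of_real)
    have "((\<lambda>w. exp (of_real \<nu> * w - exp (of_real \<nu> * w)) * - inverse ((exp w - of_real q) / (w - of_real (ln q))))
        \<longlongrightarrow> exp (of_real \<nu> * of_real (ln q) - exp (of_real \<nu> * of_real (ln q))) * - inverse (of_real q)) (at (complex_of_real (ln q)))"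
      using q by (intro tendsto_intros *) auto
    also have "(\<lambda>w. exp (of_real \<nu> * w - exp (of_real \<nu> * w)) * - inverse ((exp w - of_real q) / (w - of_real (ln q))))
        = (\<lambda>w. resolvent q w * (w - complex_of_real (ln q)))"
    proof
      fix w :: complex
      have "- inverse ((exp w - of_real q) / (w - of_real (ln q))) = (w - of_real (ln q)) / (of_real q - exp w)"
        using minus_divide_right[of "w - of_real (ln q)" "exp w - of_real q"] by simp
      then show "exp (of_real \<nu> * w - exp (of_real \<nu> * w)) * - inverse ((exp w - of_real q) / (w - of_real (ln q)))
        = resolvent q w * (w - complex_of_real (ln q))"
        by (simp add: resolvent_def)
    qed
    also have "exp (of_real \<nu> * of_real (ln q) - exp (of_real \<nu> * of_real (ln q))) * - inverse (of_real q) = complex_of_real r"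
    proof -
      have "exp (\<nu> * ln q - exp (\<nu> * ln q)) * - inverse q = r"
        using q by (simp add: r_def powr_def exp_diff exp_minus algebra_simps field_simps)
      from arg_cong[OF this, of complex_of_real] show ?thesis
        by (simp flip: exp_of_real)
    qed
    finally show "((\<lambda>w. resolvent q w * (w - complex_of_real (ln q))) \<longlongrightarrow> complex_of_real r) (at (complex_of_real (ln q)))" .
    show "integrable lborel (\<lambda>y. resolvent q (Complex y angle))"
      by (rule integrable_resolvent[OF q])
    then have "integrable lborel (\<lambda>y. cnj (resolvent q (Complex y angle)))"
      by simp
    then show "integrable lborel (\<lambda>y. resolvent q (Complex y (- angle)))"
      by (simp add: complex_cnj flip: resolvent_cnj)
    fix R v assume R: "R0 \<le> R" and v: "\<bar>v\<bar> \<le> angle"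
    have "exp (ln (q + 1)) \<le> exp R"
      using R by (simp add: R0_def)
    then have "1 \<le> exp R - q"
      using q by simp
    also have "\<dots> \<le> norm (of_real q - exp (Complex R v))"
      using norm_triangle_ineq2[of "exp (Complex R v)" "of_real q"] q by (simp add: norm_minus_commute)
    finally have d1: "1 \<le> norm (of_real q - exp (Complex R v))" .
    have "norm (resolvent q (Complex R v)) \<le> exp (\<nu> * R - cos (\<nu> * v) * exp (\<nu> * R)) / 1"
      unfolding norm_resolvent using d1 by (intro divide_left_mono) auto
    also have "\<dots> \<le> exp (\<nu> * R - damp * exp (\<nu> * R))"
      using cosv[OF v] by simp
    also have "\<dots> \<le> B R"
      using q by (simp add: B_def)
    finally show "norm (resolvent q (Complex R v)) \<le> B R" .
    have "exp (- R) \<le> exp (ln (q / 2))"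
      using R by (subst exp_le_cancel_iff) (simp add: R0_def)
    then have "q / 2 \<le> q - exp (- R)"
      using q by simp
    also have "\<dots> \<le> norm (of_real q - exp (Complex (- R) v))"
      using norm_triangle_ineq2[of "of_real q" "exp (Complex (- R) v)"] q by simp
    finally have d2: "q / 2 \<le> norm (of_real q - exp (Complex (- R) v))" .
    have "norm (resolvent q (Complex (- R) v)) \<le> exp (\<nu> * (- R) - cos (\<nu> * v) * exp (\<nu> * (- R))) / (q / 2)"
      unfolding norm_resolvent using d2 q by (intro divide_left_mono mult_pos_pos less_le_trans[OF _ d2]) auto
    also have "\<dots> \<le> exp (- \<nu> * R) / (q / 2)"
      using cosv[OF v] damp_pos q by (intro divide_right_mono exp_le_cancel_iff[THEN iffD2]) auto
    also have "\<dots> \<le> B R"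
      by (simp add: B_def mult.commute)
    finally show "norm (resolvent q (Complex (- R) v)) \<le> B R" .
  next
    show "(B \<longlongrightarrow> 0) at_top"
      unfolding B_def using \<nu> damp_pos q by real_asymp
  qed (use angle in auto)
  \<comment> \<open>Reflection in the real axis identifies the lower line with the conjugate of the
    upper one.\<close>
  also have "(\<integral>y. resolvent q (Complex y (- angle)) \<partial>lborel) = cnj T"
    using Bochner_Integration.integral_cnj[of lborel "\<lambda>y. resolvent q (Complex y angle)"]
    unfolding T_def resolvent_cnj[symmetric] by (simp add: complex_cnj)
  finally have "Im (cnj T - T) = Im (2 * of_real pi * \<i> * of_real r)"
    unfolding T_def by simp
  then have "Im T = - pi * r"
    by simp
  then show ?thesis
    by (simp add: T_def r_def)
qed

text \<open>Fubini: integrating first over x turns the phase into 1 / (q - z), that is into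
  \<open>resolvent\<close>, whose integral over the line is already known.\<close>

lemma kern_laplace:
  assumes q: "0 < q"
  shows "set_integrable lborel {0<..} (\<lambda>x. exp (- q * x) * kern 0 x)"
    and "(LINT x:{0<..}|lborel. exp (- q * x) * kern 0 x) = \<nu> * q powr (\<nu> - 1) * exp (- (q powr \<nu>))"
proof -
  define u where "u = (\<lambda>x. indicator {0<..} x * exp (- q * x) :: real)"
  \<comment> \<open>Contrary to \<open>wave_bound\<close>, the damping by e^(zx) is dropped here and
    that by e^(-z^\<nu>) kept: the majorant then splits into a function of x times a function of y
    and stays integrable down to x = 0.\<close>
  define v where "v = (\<lambda>y. exp (\<nu> * y - damp * exp (\<nu> * y)))"
  define F where "F = (\<lambda>x y. u x * Im (wave 0 x y))"
  have v: "integrable lborel v"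
    unfolding v_def using integrable_exp_minus_exp[of \<nu> \<nu> damp] damp_pos \<nu> by simp
  have u: "integrable lborel u"
    using integrable_Re[OF set_integral_cexp_Ioi(1)[of "of_real q", unfolded set_integrable_def]] q
    unfolding u_def by (simp add: Re_exp mult.commute)
  have uv: "integrable (lborel \<Otimes>\<^sub>M lborel) (\<lambda>(x, y). u x * v y)"
  proof (rule lborel_pair.Fubini_integrable)
    show "(\<lambda>(x, y). u x * v y) \<in> borel_measurable (lborel \<Otimes>\<^sub>M lborel)"
      using u v by measurable
  qed (use u v in \<open>auto simp: abs_mult\<close>)
  have "(\<lambda>(x, y). wave 0 x y) \<in> borel_measurable borel"
    by (rule borel_measurable_continuous_onI[OF continuous_on_wave])
  then have [measurable]: "(\<lambda>(x, y). wave 0 x y) \<in> borel_measurable (borel \<Otimes>\<^sub>M borel)"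
    by (simp add: borel_prod)
  have Fm: "case_prod F \<in> borel_measurable (lborel \<Otimes>\<^sub>M lborel)"
  proof -
    have "(\<lambda>p. u (fst p) * Im ((\<lambda>(x, y). wave 0 x y) p)) \<in> borel_measurable (borel \<Otimes>\<^sub>M borel)"
      unfolding u_def by measurable
    then show ?thesis
      by (simp add: F_def case_prod_unfold lborel_prod borel_prod)
  qed
  have F: "integrable (lborel \<Otimes>\<^sub>M lborel) (case_prod F)"
  proof (rule Bochner_Integration.integrable_bound[OF uv Fm], intro AE_I2)
    fix p :: "real \<times> real"
    obtain x y where p: "p = (x, y)" by force
    show "norm (case_prod F p) \<le> norm (case p of (x, y) \<Rightarrow> u x * v y)"
    proof (cases "0 < x")
      case True
      have "norm (wave 0 x y) \<le> v y"
        unfolding norm_wave v_def using True damp_pos by simp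
      then have "\<bar>Im (wave 0 x y)\<bar> \<le> \<bar>v y\<bar>"
        using abs_Im_le_cmod[of "wave 0 x y"] by linarith
      then show ?thesis
        by (auto simp: p F_def abs_mult intro!: mult_left_mono)
    qed (simp add: p F_def u_def)
  qed
  have inner_y: "(\<integral>y. F x y \<partial>lborel) = indicator {0<..} x *\<^sub>R (exp (- q * x) * (pi / \<nu> * kern 0 x))" for x
    using \<nu> by (simp add: F_def u_def kern_def)
  have inner_x: "(\<integral>x. F x y \<partial>lborel) = Im (resolvent q (Complex y angle))" for y
  proof -
    define c where "c = of_real q - exp (Complex y angle)"
    have c: "0 < Re c"
      using q damp_pos by (simp add: c_def Re_exp cos_angle add_pos_nonneg)
    define N where "N = exp (of_real \<nu> * Complex y angle - exp (of_real \<nu> * Complex y angle))"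
    have eq: "F x y = Im (N * (indicator {0<..} x *\<^sub>R exp (- (of_real x * c))))" for x
    proof -
      have "exp (- (q * x)) *\<^sub>R wave 0 x y = N * exp (- (of_real x * c))"
        unfolding wave_def N_def c_def scaleR_conv_of_real
        by (simp add: algebra_simps flip: exp_add exp_of_real)
      from arg_cong[OF this, of Im] show ?thesis
        by (auto simp: F_def u_def split: split_indicator)
    qed
    have int: "integrable lborel (\<lambda>x. N * (indicator {0<..} x *\<^sub>R exp (- (of_real x * c))))"
      using set_integral_cexp_Ioi(1)[OF c] unfolding set_integrable_def by (rule integrable_mult_right)
    have "(\<integral>x. F x y \<partial>lborel) = Im (\<integral>x. N * (indicator {0<..} x *\<^sub>R exp (- (of_real x * c))) \<partial>lborel)"
      unfolding eq by (rule integral_Im[OF int])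
    also have "\<dots> = Im (N * (1 / c))"
      using set_integral_cexp_Ioi[OF c] unfolding set_lebesgue_integral_def set_integrable_def
      by (simp only: integral_mult_right_zero)
    finally show ?thesis
      by (simp add: resolvent_def N_def c_def)
  qed
  have "integrable lborel (\<lambda>x. \<integral>y. F x y \<partial>lborel)"
    using lborel_pair.integrable_fst[OF F] by simp
  then have "integrable lborel (\<lambda>x. \<nu> / pi * (indicator {0<..} x *\<^sub>R (exp (- q * x) * (pi / \<nu> * kern 0 x))))"
    unfolding inner_y by (rule integrable_mult_right)
  also have "(\<lambda>x. \<nu> / pi * (indicator {0<..} x *\<^sub>R (exp (- q * x) * (pi / \<nu> * kern 0 x))))
      = (\<lambda>x. indicator {0<..} x *\<^sub>R (exp (- q * x) * kern 0 x))"
    using \<nu> by (auto simp: fun_eq_iff)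
  finally show "set_integrable lborel {0<..} (\<lambda>x. exp (- q * x) * kern 0 x)"
    unfolding set_integrable_def .
  have "(\<integral>x. (\<integral>y. F x y \<partial>lborel) \<partial>lborel) = (\<integral>y. (\<integral>x. F x y \<partial>lborel) \<partial>lborel)"
    by (rule lborel_pair.Fubini_integral[OF F, symmetric])
  also have "\<dots> = pi * q powr (\<nu> - 1) * exp (- (q powr \<nu>))"
    unfolding inner_x using integral_Im[OF integrable_resolvent[OF q]] Im_integral_resolvent[OF q] by simp
  finally have "(LINT x:{0<..}|lborel. pi / \<nu> * (exp (- q * x) * kern 0 x)) = pi * q powr (\<nu> - 1) * exp (- (q powr \<nu>))"
    unfolding inner_y set_lebesgue_integral_def by (simp add: mult_ac)
  then show "(LINT x:{0<..}|lborel. exp (- q * x) * kern 0 x) = \<nu> * q powr (\<nu> - 1) * exp (- (q powr \<nu>))"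
    using \<nu> by (simp add: field_simps)
qed

end

subsection \<open>Identification of the densities\<close>

context stable_index
begin

text \<open>Continuity is established on the positive half-line only, so measurability on the whole
  line is taken from the joint measurability of the integrand.\<close>

lemma kern_measurable [measurable]: "kern n \<in> borel_measurable borel"
proof -
  have "(\<lambda>(x, y). wave n x y) \<in> borel_measurable borel"
    by (rule borel_measurable_continuous_onI[OF continuous_on_wave])
  then have "(\<lambda>(x, y). wave n x y) \<in> borel_measurable (borel \<Otimes>\<^sub>M lborel)"
    by (simp add: borel_prod measurable_cong_sets[OF sets_pair_measure_cong[OF refl sets_lborel] refl])
  then have "(\<lambda>(x, y). Im (wave n x y)) \<in> borel_measurable (borel \<Otimes>\<^sub>M lborel)"
    by (simp add: case_prod_unfold)
  then have "(\<lambda>x. \<integral>y. Im (wave n x y) \<partial>lborel) \<in> borel_measurable borel"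
    by (rule lborel.borel_measurable_lebesgue_integral)
  then show ?thesis
    unfolding kern_def[abs_def] by simp
qed

end

text \<open>The analytic content of the probabilistic hypotheses, one time slice at a time.
  Smoothness in time is not postulated; it follows from \<open>h_eq_kern\<close>.\<close>

locale stable_density = stable_index +
  fixes h :: "real \<Rightarrow> real \<Rightarrow> real"
  assumes h_cont: "0 < t \<Longrightarrow> continuous_on {0<..} (\<lambda>x. h x t)"
    and h_nonneg: "0 < t \<Longrightarrow> 0 < x \<Longrightarrow> 0 \<le> h x t"
    and h_integrable: "0 < t \<Longrightarrow> set_integrable lborel {0<..} (\<lambda>x. h x t)"
    and h_laplace: "0 < t \<Longrightarrow> 0 < q \<Longrightarrow> (LINT x:{0<..}|lborel. exp (- q * x) * h x t) = exp (- t * q powr \<nu>)"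
begin

lemma h_exp_integrable:
  assumes "0 < t" "0 < q"
  shows "set_integrable lborel {0<..} (\<lambda>x. exp (- q * x) * h x t)"
proof (rule set_integrable_bound[OF h_integrable[OF assms(1)]])
  have "(\<lambda>x. indicator {0<..} x *\<^sub>R h x t) \<in> borel_measurable lborel"
    using h_integrable[OF assms(1)] unfolding set_integrable_def by simp
  then have "(\<lambda>x. exp (- q * x) * (indicator {0<..} x *\<^sub>R h x t)) \<in> borel_measurable lborel"
    by measurable
  then show "set_borel_measurable lborel {0<..} (\<lambda>x. exp (- q * x) * h x t)"
    by (simp add: set_borel_measurable_def mult_ac)
qed (use assms in \<open>auto intro!: AE_I2 mult_left_le_one_le simp: abs_mult\<close>)

text \<open>Differentiation of the Laplace transform in q. The factor x brought down produces the
  function that \<open>kern 0\<close> represents.\<close>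

lemma h_first_moment_laplace:
  assumes t: "0 < t" and q: "0 < q"
  shows "set_integrable lborel {0<..} (\<lambda>x. exp (- q * x) * (x * h x t))"
    and "(LINT x:{0<..}|lborel. exp (- q * x) * (x * h x t)) = t * \<nu> * q powr (\<nu> - 1) * exp (- t * q powr \<nu>)"
proof -
  define K where "K = (\<lambda>q x. indicator {0<..} x * (exp (- q * x) * h x t))"
  define K' where "K' = (\<lambda>q x. indicator {0<..} x * (exp (- q * x) * (- x * h x t)))"
  have K: "integrable lborel (K q)" "(\<integral>x. K q x \<partial>lborel) = exp (- t * q powr \<nu>)" if "0 < q" for q
    using h_exp_integrable[OF t that] h_laplace[OF t that]
    unfolding K_def set_integrable_def set_lebesgue_integral_def by simp_all
  have D: "((\<lambda>q. \<integral>x. K q x \<partial>lborel) has_real_derivative (\<integral>x. K' q x \<partial>lborel)) (at q)"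
    and I: "integrable lborel (K' q)"
  proof -
    have *: "((\<lambda>q. K q x) has_real_derivative K' q x) (at q)" for q x
      unfolding K_def K'_def by (auto intro!: derivative_eq_intros)
    \<comment> \<open>For p > q / 2, x exp (- p x) is at most x exp (- (q / 2) x), which is at most
      2 / q by \<open>powr_times_exp_le\<close> with exponent 1.\<close>
    have **: "\<bar>K' p x\<bar> \<le> 2 / q * (indicator {0<..} x * h x t)" if "p \<in> {q / 2<..<2 * q}" for p x
    proof (cases "0 < x")
      case True
      have "x * exp (- p * x) \<le> x * exp (- (q / 2 * x))"
        using that True by (intro mult_left_mono) auto
      also have "\<dots> \<le> 2 / q"
        using powr_times_exp_le[of "q / 2" 1 x] q True by simp
      finally have "x * exp (- p * x) * h x t \<le> 2 / q * h x t"
        using h_nonneg[OF t True] by (intro mult_right_mono) auto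
      then show ?thesis
        using True h_nonneg[OF t True] by (simp add: K'_def abs_mult mult_ac)
    qed (simp add: K'_def)
    have B: "integrable lborel (\<lambda>x. 2 / q * (indicator {0<..} x * h x t))"
      using h_integrable[OF t] unfolding set_integrable_def by simp
    show "((\<lambda>q. \<integral>x. K q x \<partial>lborel) has_real_derivative (\<integral>x. K' q x \<partial>lborel)) (at q)" "integrable lborel (K' q)"
      by (rule has_real_derivative_integral[where a = "q / 2" and b = "2 * q", OF _ K(1) * ** B]; use q in simp)+
  qed
  have "((\<lambda>q. exp (- t * q powr \<nu>)) has_real_derivative (\<integral>x. K' q x \<partial>lborel)) (at q)"
    by (rule has_field_derivative_transform_within_open[OF D, of "{0<..}"]) (use K q in auto)
  moreover have "((\<lambda>q. exp (- t * q powr \<nu>)) has_real_derivative exp (- t * q powr \<nu>) * (- t * (\<nu> * q powr (\<nu> - 1)))) (at q)"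
    using q by (auto intro!: derivative_eq_intros)
  ultimately have eq: "(\<integral>x. K' q x \<partial>lborel) = exp (- t * q powr \<nu>) * (- t * (\<nu> * q powr (\<nu> - 1)))"
    by (rule DERIV_unique)
  have K': "K' q x = - (indicator {0<..} x *\<^sub>R (exp (- q * x) * (x * h x t)))" for x
    by (simp add: K'_def)
  show "set_integrable lborel {0<..} (\<lambda>x. exp (- q * x) * (x * h x t))"
    using I unfolding set_integrable_def K' by simp
  show "(LINT x:{0<..}|lborel. exp (- q * x) * (x * h x t)) = t * \<nu> * q powr (\<nu> - 1) * exp (- t * q powr \<nu>)"
    using eq unfolding set_lebesgue_integral_def K' by simp
qed

text \<open>Self-similarity: the process at time y scales like y^(1/\<nu>) times the process at time
  1. Both x h(x, y) and \<open>kern 0 (x * \<kappa>)\<close> have the transform y \<nu> q^(\<nu> -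
  1) exp (- y q^\<nu>), and both are continuous, so they agree at every point. The right-hand side
  is visibly differentiable in y.\<close>

lemma h_eq_kern:
  assumes s: "0 < s" and y: "0 < y"
  shows "h s y = kern 0 (s * y powr (- 1 / \<nu>)) / s"
proof -
  define \<kappa> where "\<kappa> = y powr (- 1 / \<nu>)"
  have \<kappa>: "0 < \<kappa>" using y by (simp add: \<kappa>_def)
  have \<kappa>\<nu>: "\<kappa> powr (- \<nu>) = y"
    using y \<nu> by (simp add: \<kappa>_def powr_powr)
  have L: "set_integrable lborel {0<..} (\<lambda>x. exp (- q * x) * kern 0 (x * \<kappa>))"
    "(LINT x:{0<..}|lborel. exp (- q * x) * kern 0 (x * \<kappa>)) = y * \<nu> * q powr (\<nu> - 1) * exp (- y * q powr \<nu>)"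
    if q: "0 < q" for q
  proof -
    have eq: "indicator {0<..} x *\<^sub>R (exp (- q * x) * kern 0 (x * \<kappa>))
        = indicator {0<..} (0 + \<kappa> * x) *\<^sub>R (exp (- (q / \<kappa>) * (0 + \<kappa> * x)) * kern 0 (0 + \<kappa> * x))" for x
      using \<kappa> by (auto simp: indicator_def zero_less_mult_iff mult_ac)
    have q\<kappa>: "0 < q / \<kappa>" using q \<kappa> by simp
    show "set_integrable lborel {0<..} (\<lambda>x. exp (- q * x) * kern 0 (x * \<kappa>))"
      unfolding set_integrable_def eq
      by (subst lborel_integrable_real_affine_iff) (use \<kappa> kern_laplace(1)[OF q\<kappa>] in \<open>auto simp: set_integrable_def\<close>)
    have "\<nu> * (q / \<kappa>) powr (\<nu> - 1) * exp (- ((q / \<kappa>) powr \<nu>)) =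
        \<bar>\<kappa>\<bar> *\<^sub>R (LINT x:{0<..}|lborel. exp (- q * x) * kern 0 (x * \<kappa>))"
      unfolding kern_laplace(2)[OF q\<kappa>, symmetric] set_lebesgue_integral_def eq
      by (rule lborel_integral_real_affine) (use \<kappa> in simp)
    moreover have "(q / \<kappa>) powr \<nu> = y * q powr \<nu>"
      using q \<kappa> by (simp add: powr_divide flip: \<kappa>\<nu>) (simp add: powr_minus field_simps)
    moreover have "(q / \<kappa>) powr (\<nu> - 1) = \<kappa> * (y * q powr (\<nu> - 1))"
      using q \<kappa> by (simp add: powr_divide flip: \<kappa>\<nu>) (simp add: powr_minus powr_diff field_simps)
    ultimately show "(LINT x:{0<..}|lborel. exp (- q * x) * kern 0 (x * \<kappa>)) = y * \<nu> * q powr (\<nu> - 1) * exp (- y * q powr \<nu>)"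
      using \<kappa> by (simp add: mult_ac)
  qed
  have "AE x in lborel. 0 < x \<longrightarrow> x * h x y - kern 0 (x * \<kappa>) = 0"
  proof (rule laplace_eq_zero_imp_AE_zero)
    fix q :: real assume q: "0 < q"
    note i = h_first_moment_laplace[OF y q] L[OF q]
    show "set_integrable lborel {0<..} (\<lambda>x. exp (- q * x) * (x * h x y - kern 0 (x * \<kappa>)))"
      using set_integral_diff(1)[OF i(1) i(3)] by (simp add: right_diff_distrib)
    show "(LINT x:{0<..}|lborel. exp (- q * x) * (x * h x y - kern 0 (x * \<kappa>))) = 0"
      using set_integral_diff(2)[OF i(1) i(3)] i(2,4) by (simp add: right_diff_distrib)
  qed
  moreover have "continuous_on {0<..} (\<lambda>x. x * h x y - kern 0 (x * \<kappa>))"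
  proof (intro continuous_intros h_cont y)
    have "continuous_on {0<..} (kern 0)"
      using kern_isCont by (auto intro!: continuous_at_imp_continuous_on)
    then show "continuous_on {0<..} (\<lambda>x. kern 0 (x * \<kappa>))"
      by (rule continuous_on_compose2) (use \<kappa> in \<open>auto intro!: continuous_intros\<close>)
  qed
  ultimately have "s * h s y - kern 0 (s * \<kappa>) = 0"
    by (intro AE_zero_continuous_on_Ioi[of "\<lambda>x. x * h x y - kern 0 (x * \<kappa>)"]) (use s in auto)
  then show ?thesis
    using s by (simp add: \<kappa>_def field_simps)
qed

text \<open>By the scaling form, the y-derivative of h(s, y) equals - 1 / (\<nu> y) times the
  s-derivative of \<open>kern 0 (s * \<kappa>)\<close>. The integral over s > t is therefore
  evaluated by the fundamental theorem of calculus.\<close>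

lemma inverse_density_eq:
  assumes y: "0 < y" and t: "0 < t"
  shows "inverse_density h y t = kern 0 (t * y powr (- 1 / \<nu>)) / (\<nu> * y)"
proof -
  define \<kappa> where "\<kappa> = y powr (- 1 / \<nu>)"
  have \<kappa>: "0 < \<kappa>" using y by (simp add: \<kappa>_def)
  have deriv: "deriv (\<lambda>y. h s y) y = - (\<kappa> / (\<nu> * y)) * kern 1 (s * \<kappa>)" if s: "0 < s" for s
  proof (rule DERIV_imp_deriv)
    have "((\<lambda>y. kern 0 (s * y powr (- 1 / \<nu>)) / s) has_real_derivative
        kern (Suc 0) (s * y powr (- 1 / \<nu>)) * (s * ((- 1 / \<nu>) * y powr (- 1 / \<nu> - 1))) / s) (at y)"
      using y s by (intro DERIV_cdivide DERIV_chain2[OF kern_has_derivative])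
        (auto intro!: derivative_eq_intros)
    also have "kern (Suc 0) (s * y powr (- 1 / \<nu>)) * (s * ((- 1 / \<nu>) * y powr (- 1 / \<nu> - 1))) / s
        = - (\<kappa> / (\<nu> * y)) * kern 1 (s * \<kappa>)"
      using y s by (simp add: \<kappa>_def powr_diff)
    finally show "((\<lambda>y. h s y) has_real_derivative - (\<kappa> / (\<nu> * y)) * kern 1 (s * \<kappa>)) (at y)"
      by (rule has_field_derivative_transform_within_open[of _ _ _ "{0<..}"]) (use y s h_eq_kern in auto)
  qed
  have int: "set_integrable lborel {t<..} (\<lambda>s. - (\<kappa> / (\<nu> * y)) * kern 1 (s * \<kappa>))"
  proof -
    \<comment> \<open>The comparison function is the decay rate of \<open>kern 1\<close> from
      \<open>kern_bound\<close>.\<close>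
    have "set_integrable lborel (einterval t \<infinity>) (\<lambda>s. s powr (- \<nu> - 1))"
    proof (rule interval_integral_FTC_nonneg(1)[where F = "\<lambda>s. - (s powr (- \<nu>)) / \<nu>" and A = "- (t powr (- \<nu>)) / \<nu>" and B = 0])
      show "(((\<lambda>s. - (s powr (- \<nu>)) / \<nu>) \<circ> real_of_ereal) \<longlongrightarrow> - (t powr (- \<nu>)) / \<nu>) (at_right (ereal t))"
        unfolding ereal_tendsto_simps1 using t \<nu> by (auto intro!: tendsto_eq_intros)
      show "(((\<lambda>s. - (s powr (- \<nu>)) / \<nu>) \<circ> real_of_ereal) \<longlongrightarrow> 0) (at_left \<infinity>)"
        unfolding ereal_tendsto_simps1 using \<nu> by real_asymp
    qed (use t \<nu> in \<open>auto intro!: derivative_eq_intros continuous_intros\<close>)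
    then have *: "set_integrable lborel {t<..} (\<lambda>s. s powr (- \<nu> - 1))"
      by (simp add: einterval_def greaterThan_def)
    have "set_integrable lborel {t<..} (\<lambda>s. kern 1 (s * \<kappa>))"
    proof (rule set_integrable_bound[OF set_integrable_mult_right[OF *, of "decay 1 * \<kappa> powr (- \<nu> - 1)"]])
      show "AE s in lborel. s \<in> {t<..} \<longrightarrow> norm (kern 1 (s * \<kappa>)) \<le> norm (decay 1 * \<kappa> powr (- \<nu> - 1) * s powr (- \<nu> - 1))"
      proof (intro AE_I2 impI)
        fix s assume "s \<in> {t<..}"
        then have s: "0 < s" using t by simp
        have "\<bar>kern 1 (s * \<kappa>)\<bar> \<le> decay 1 * (s * \<kappa>) powr (- (\<nu> + 1))"
          using kern_bound[of "s * \<kappa>" 1] s \<kappa> by simp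
        also have "\<dots> = decay 1 * \<kappa> powr (- \<nu> - 1) * s powr (- \<nu> - 1)"
          using s \<kappa> by (simp add: powr_mult)
        finally show "norm (kern 1 (s * \<kappa>)) \<le> norm (decay 1 * \<kappa> powr (- \<nu> - 1) * s powr (- \<nu> - 1))"
          by simp
      qed
    qed (simp add: set_borel_measurable_def)
    then show ?thesis
      by (intro set_integrable_mult_right)
  qed
  have "inverse_density h y t = (LINT s:{t<..}|lborel. - (\<kappa> / (\<nu> * y)) * kern 1 (s * \<kappa>))"
    unfolding inverse_density_def by (rule set_lebesgue_integral_cong) (use deriv t in auto)
  also have "\<dots> = (LBINT s=t..\<infinity>. - (\<kappa> / (\<nu> * y)) * kern 1 (s * \<kappa>))"
    by (simp add: interval_lebesgue_integral_def einterval_def greaterThan_def)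
  also have "\<dots> = 0 - (- (1 / (\<nu> * y)) * kern 0 (t * \<kappa>))"
  proof (rule interval_integral_FTC_integrable[where F = "\<lambda>s. - (1 / (\<nu> * y)) * kern 0 (s * \<kappa>)"])
    fix s assume "ereal t < ereal s"
    then have s: "0 < s * \<kappa>" using t \<kappa> by simp
    have "((\<lambda>s. - (1 / (\<nu> * y)) * kern 0 (s * \<kappa>)) has_real_derivative - (1 / (\<nu> * y)) * (kern (Suc 0) (s * \<kappa>) * \<kappa>)) (at s)"
      using s by (intro DERIV_cmult DERIV_chain2[OF kern_has_derivative]) (auto intro!: derivative_eq_intros)
    then show "((\<lambda>s. - (1 / (\<nu> * y)) * kern 0 (s * \<kappa>)) has_vector_derivative - (\<kappa> / (\<nu> * y)) * kern 1 (s * \<kappa>)) (at s)"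
      by (simp add: has_real_derivative_iff_has_vector_derivative mult_ac)
    show "isCont (\<lambda>s. - (\<kappa> / (\<nu> * y)) * kern 1 (s * \<kappa>)) s"
      by (intro continuous_intros isCont_o2[OF _ kern_isCont] s)
  next
    have "isCont (\<lambda>s. - (1 / (\<nu> * y)) * kern 0 (s * \<kappa>)) t"
      using t \<kappa> by (intro continuous_intros isCont_o2[OF _ kern_isCont]) auto
    then show "(((\<lambda>s. - (1 / (\<nu> * y)) * kern 0 (s * \<kappa>)) \<circ> real_of_ereal) \<longlongrightarrow> - (1 / (\<nu> * y)) * kern 0 (t * \<kappa>)) (at_right (ereal t))"
      unfolding ereal_tendsto_simps1 isCont_def by (rule tendsto_within_subset) simp
    \<comment> \<open>The boundary term at infinity; only the value at s = t survives.\<close>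
    have "((\<lambda>s. kern 0 (s * \<kappa>)) \<longlongrightarrow> 0) at_top"
    proof (rule Lim_null_comparison)
      show "\<forall>\<^sub>F s in at_top. norm (kern 0 (s * \<kappa>)) \<le> decay 0 * (s * \<kappa>) powr (- \<nu>)"
        using eventually_gt_at_top[of 0]
        by eventually_elim (use kern_bound[of _ 0] \<kappa> in auto)
      show "((\<lambda>s. decay 0 * (s * \<kappa>) powr (- \<nu>)) \<longlongrightarrow> 0) at_top"
        using \<kappa> \<nu> by real_asymp
    qed
    from tendsto_mult_right_zero[OF this]
    show "(((\<lambda>s. - (1 / (\<nu> * y)) * kern 0 (s * \<kappa>)) \<circ> real_of_ereal) \<longlongrightarrow> 0) (at_left \<infinity>)"
      unfolding ereal_tendsto_simps1 .
    show "set_integrable lborel (einterval t \<infinity>) (\<lambda>s. - (\<kappa> / (\<nu> * y)) * kern 1 (s * \<kappa>))"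
      using int by (simp add: einterval_def greaterThan_def)
  qed simp
  finally show ?thesis
    by (simp add: \<kappa>_def)
qed

section \<open>The density at time one and its Abel integral equation\<close>

definition dens :: "real \<Rightarrow> real" where
  "dens z = indicator {0<..} z * h z 1"

lemma dens_nonneg: "0 \<le> dens z"
  using h_nonneg[of 1 z] by (auto simp: dens_def indicator_def)

lemma dens_integrable: "integrable lborel dens"
  using h_integrable[of 1] unfolding set_integrable_def dens_def by simp

lemma dens_measurable [measurable]: "dens \<in> borel_measurable borel"
  using dens_integrable by auto

lemma dens_eq_kern: "0 < z \<Longrightarrow> dens z = kern 0 z / z"
  using h_eq_kern[of z 1] by (simp add: dens_def)

text \<open>Euler's integral after the scaling T to T / q. The nonnegative integral is used so that
  it fits Tonelli's theorem without a prior integrability proof.\<close>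

lemma Gamma_laplace:
  assumes q: "0 < q"
  shows "(\<integral>\<^sup>+T. ennreal (if 0 < T then exp (- q * T) * T powr (- \<nu>) else 0) \<partial>lborel) = ennreal (Gamma (1 - \<nu>) * q powr (\<nu> - 1))"
proof -
  have "(\<integral>\<^sup>+T. ennreal (if 0 < T then exp (- q * T) * T powr (- \<nu>) else 0) \<partial>lborel)
      = ennreal \<bar>1 / q\<bar> * (\<integral>\<^sup>+T. ennreal (if 0 < 0 + 1 / q * T then exp (- q * (0 + 1 / q * T)) * (0 + 1 / q * T) powr (- \<nu>) else 0) \<partial>lborel)"
    by (rule nn_integral_real_affine) (use q in auto)
  also have "(\<integral>\<^sup>+T. ennreal (if 0 < 0 + 1 / q * T then exp (- q * (0 + 1 / q * T)) * (0 + 1 / q * T) powr (- \<nu>) else 0) \<partial>lborel)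
     = (\<integral>\<^sup>+T. ennreal (q powr \<nu>) * ennreal (indicator {0..} T * T powr (1 - \<nu> - 1) / exp T) \<partial>lborel)"
  proof (intro nn_integral_cong)
    fix T :: real
    show "ennreal (if 0 < 0 + 1 / q * T then exp (- q * (0 + 1 / q * T)) * (0 + 1 / q * T) powr (- \<nu>) else 0)
      = ennreal (q powr \<nu>) * ennreal (indicator {0..} T * T powr (1 - \<nu> - 1) / exp T)"
    proof (cases "0 < T")
      case True
      then show ?thesis
        using q by (simp add: powr_divide powr_minus exp_minus field_simps flip: ennreal_mult)
    next
      case False
      then have "\<not> 0 < T / q" using q by (simp add: field_simps)
      then show ?thesis
        using False by (auto simp: indicator_def)
    qed
  qed
  also have "\<dots> = ennreal (q powr \<nu>) * ennreal (Gamma (1 - \<nu>))"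
    using \<nu> by (subst nn_integral_cmult) (auto simp: Gamma_conv_nn_integral_real)
  also have "ennreal \<bar>1 / q\<bar> * \<dots> = ennreal (Gamma (1 - \<nu>) * q powr (\<nu> - 1))"
    using q \<nu> by (simp add: powr_diff Gamma_real_pos flip: ennreal_mult)
  finally show ?thesis .
qed

text \<open>On the Laplace side this reads \<open>\<nu> q\<^bsup>\<nu> - 1\<^esup> exp (- q\<^bsup>\<nu>\<^esup>) = - d/dq exp (- q\<^bsup>\<nu>\<^esup>)\<close>.\<close>

lemma abel_identity:
  "AE T in lborel. 0 < T \<longrightarrow>
    (\<integral>\<^sup>+w. ennreal (if w < T then (T - w) powr (- \<nu>) * dens w else 0) \<partial>lborel)
      = ennreal (Gamma (1 - \<nu>) / \<nu> * kern 0 T)"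
proof -
  define J where "J = (\<lambda>T. \<integral>\<^sup>+w. ennreal (if w < T then (T - w) powr (- \<nu>) * dens w else 0) \<partial>lborel)"
  have Jm [measurable]: "J \<in> borel_measurable borel"
    unfolding J_def by measurable
  have dens0: "dens w = 0" if "w \<le> 0" for w
    using that by (simp add: dens_def)
  have G: "0 < Gamma (1 - \<nu>)"
    using \<nu> by (simp add: Gamma_real_pos)
  have L: "(\<integral>\<^sup>+T. ennreal (if 0 < T then exp (- q * T) else 0) * J T \<partial>lborel)
      = ennreal (Gamma (1 - \<nu>) * q powr (\<nu> - 1) * exp (- (q powr \<nu>)))" if q: "0 < q" for q
  proof -
    have "(\<integral>\<^sup>+T. ennreal (if 0 < T then exp (- q * T) else 0) * J T \<partial>lborel)
        = (\<integral>\<^sup>+T. \<integral>\<^sup>+w. ennreal (if w < T then exp (- q * T) * ((T - w) powr (- \<nu>) * dens w) else 0) \<partial>lborel \<partial>lborel)"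
    proof (intro nn_integral_cong)
      fix T
      show "ennreal (if 0 < T then exp (- q * T) else 0) * J T
        = (\<integral>\<^sup>+w. ennreal (if w < T then exp (- q * T) * ((T - w) powr (- \<nu>) * dens w) else 0) \<partial>lborel)"
      proof (cases "0 < T")
        case True
        then show ?thesis
          unfolding J_def using dens_nonneg
          by (subst nn_integral_cmult[symmetric]) (auto intro!: nn_integral_cong simp: ennreal_mult)
      next
        case False
        then have "(if w < T then exp (- q * T) * ((T - w) powr (- \<nu>) * dens w) else 0) = 0" for w
          by (simp add: dens0)
        then show ?thesis
          using False by simp
      qed
    qed
    also have "\<dots> = (\<integral>\<^sup>+w. \<integral>\<^sup>+T. ennreal (if w < T then exp (- q * T) * ((T - w) powr (- \<nu>) * dens w) else 0) \<partial>lborel \<partial>lborel)"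
      by (rule lborel_pair.Fubini') measurable
    \<comment> \<open>The shift of T by w separates the two factors: the transform of the
      convolution of T^(-\<nu>) and \<open>dens\<close> is the product of their transforms.\<close>
    also have "\<dots> = (\<integral>\<^sup>+w. ennreal (exp (- q * w) * dens w) * ennreal (Gamma (1 - \<nu>) * q powr (\<nu> - 1)) \<partial>lborel)"
    proof (intro nn_integral_cong)
      fix w
      have "(\<integral>\<^sup>+T. ennreal (if w < T then exp (- q * T) * ((T - w) powr (- \<nu>) * dens w) else 0) \<partial>lborel)
         = ennreal \<bar>1\<bar> * (\<integral>\<^sup>+T. ennreal (if w < w + 1 * T then exp (- q * (w + 1 * T)) * ((w + 1 * T - w) powr (- \<nu>) * dens w) else 0) \<partial>lborel)"
        by (rule nn_integral_real_affine) auto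
      also have "\<dots> = (\<integral>\<^sup>+T. ennreal (exp (- q * w) * dens w) * ennreal (if 0 < T then exp (- q * T) * T powr (- \<nu>) else 0) \<partial>lborel)"
        using dens_nonneg[of w]
        by (auto intro!: nn_integral_cong simp: exp_add[symmetric] algebra_simps simp flip: ennreal_mult)
      also have "\<dots> = ennreal (exp (- q * w) * dens w) * ennreal (Gamma (1 - \<nu>) * q powr (\<nu> - 1))"
        by (subst nn_integral_cmult) (auto simp: Gamma_laplace[OF q])
      finally show "(\<integral>\<^sup>+T. ennreal (if w < T then exp (- q * T) * ((T - w) powr (- \<nu>) * dens w) else 0) \<partial>lborel)
        = ennreal (exp (- q * w) * dens w) * ennreal (Gamma (1 - \<nu>) * q powr (\<nu> - 1))" .
    qed
    also have "\<dots> = (\<integral>\<^sup>+w. ennreal (exp (- q * w) * dens w) \<partial>lborel) * ennreal (Gamma (1 - \<nu>) * q powr (\<nu> - 1))"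
      by (rule nn_integral_multc) measurable
    also have "(\<integral>\<^sup>+w. ennreal (exp (- q * w) * dens w) \<partial>lborel) = ennreal (exp (- (q powr \<nu>)))"
    proof -
      have eq: "exp (- q * w) * dens w = indicator {0<..} w *\<^sub>R (exp (- q * w) * h w 1)" for w
        by (simp add: dens_def)
      have "integrable lborel (\<lambda>w. exp (- q * w) * dens w)"
        unfolding eq using h_exp_integrable[of 1, OF _ q] by (simp add: set_integrable_def)
      then have "(\<integral>\<^sup>+w. ennreal (exp (- q * w) * dens w) \<partial>lborel) = ennreal (\<integral>w. exp (- q * w) * dens w \<partial>lborel)"
        by (rule nn_integral_eq_integral) (use dens_nonneg in auto)
      moreover have "(\<integral>w. exp (- q * w) * dens w \<partial>lborel) = exp (- (q powr \<nu>))"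
        unfolding eq using h_laplace[of 1, OF _ q] by (simp add: set_lebesgue_integral_def)
      ultimately show ?thesis
        by simp
    qed
    finally show ?thesis
      using G by (simp add: mult_ac flip: ennreal_mult)
  qed
  \<comment> \<open>A finite transform at q = 1 forces J to be finite almost everywhere. Hence the
    real-valued \<open>j\<close>, to which Laplace uniqueness applies, loses nothing.\<close>
  have fin: "AE T in lborel. 0 < T \<longrightarrow> J T \<noteq> \<infinity>"
  proof -
    have "AE T in lborel. ennreal (if 0 < T then exp (- 1 * T) else 0) * J T \<noteq> \<infinity>"
      by (rule nn_integral_PInf_AE) (use L[of 1] in auto)
    then show ?thesis
      by eventually_elim (auto simp: ennreal_mult_eq_top_iff split: if_splits)
  qed
  define j where "j = (\<lambda>T. enn2real (J T))"
  have jm [measurable]: "j \<in> borel_measurable borel"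
    unfolding j_def by measurable
  have j0: "0 \<le> j T" for T by (simp add: j_def)
  have jL: "set_integrable lborel {0<..} (\<lambda>T. exp (- q * T) * j T)"
    "(LINT T:{0<..}|lborel. exp (- q * T) * j T) = Gamma (1 - \<nu>) * q powr (\<nu> - 1) * exp (- (q powr \<nu>))" if q: "0 < q" for q
  proof -
    have "(\<integral>\<^sup>+T. ennreal (indicator {0<..} T *\<^sub>R (exp (- q * T) * j T)) \<partial>lborel)
        = (\<integral>\<^sup>+T. ennreal (if 0 < T then exp (- q * T) else 0) * J T \<partial>lborel)"
    proof (rule nn_integral_cong_AE)
      show "AE T in lborel. ennreal (indicator {0<..} T *\<^sub>R (exp (- q * T) * j T)) = ennreal (if 0 < T then exp (- q * T) else 0) * J T"
        using fin by eventually_elim (auto simp: j_def ennreal_mult less_top ennreal_enn2real)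
    qed
    then have "has_bochner_integral lborel (\<lambda>T. indicator {0<..} T *\<^sub>R (exp (- q * T) * j T)) (Gamma (1 - \<nu>) * q powr (\<nu> - 1) * exp (- (q powr \<nu>)))"
      using j0 G L[OF q] by (intro has_bochner_integral_nn_integral) auto
    then show "set_integrable lborel {0<..} (\<lambda>T. exp (- q * T) * j T)"
      "(LINT T:{0<..}|lborel. exp (- q * T) * j T) = Gamma (1 - \<nu>) * q powr (\<nu> - 1) * exp (- (q powr \<nu>))"
      unfolding set_integrable_def set_lebesgue_integral_def has_bochner_integral_iff by auto
  qed
  have "AE T in lborel. 0 < T \<longrightarrow> kern 0 T - \<nu> / Gamma (1 - \<nu>) * j T = 0"
  proof (rule laplace_eq_zero_imp_AE_zero)
    fix q :: real assume q: "0 < q"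
    note i = kern_laplace[OF q] set_integrable_mult_right[OF jL(1)[OF q], of "\<nu> / Gamma (1 - \<nu>)"]
    have eq: "exp (- q * T) * (kern 0 T - \<nu> / Gamma (1 - \<nu>) * j T) = exp (- q * T) * kern 0 T - \<nu> / Gamma (1 - \<nu>) * (exp (- q * T) * j T)" for T
      by (simp add: algebra_simps)
    show "set_integrable lborel {0<..} (\<lambda>T. exp (- q * T) * (kern 0 T - \<nu> / Gamma (1 - \<nu>) * j T))"
      unfolding eq using i(1,3) by (rule set_integral_diff(1))
    show "(LINT T:{0<..}|lborel. exp (- q * T) * (kern 0 T - \<nu> / Gamma (1 - \<nu>) * j T)) = 0"
      unfolding eq using i G jL(2)[OF q] by (subst set_integral_diff(2)) auto
  qed
  with fin have "AE T in lborel. 0 < T \<longrightarrow> J T = ennreal (Gamma (1 - \<nu>) / \<nu> * kern 0 T)"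
  proof eventually_elim
    case (elim T)
    show ?case
    proof
      assume T: "0 < T"
      then have "j T = Gamma (1 - \<nu>) / \<nu> * kern 0 T"
        using elim G \<nu> by (simp add: field_simps)
      moreover have "J T = ennreal (j T)"
        using elim T by (simp add: j_def less_top ennreal_enn2real)
      ultimately show "J T = ennreal (Gamma (1 - \<nu>) / \<nu> * kern 0 T)"
        by simp
    qed
  qed
  then show ?thesis
    unfolding J_def .
qed

end

subsection \<open>Mixtures of gamma kernels\<close>

text \<open>With r = 1 / s and b = \<mu> this is the s-dependent part of \<open>g_tilde\<close>.
  Leaving b free closes the family under differentiation: a derivative in x only brings down - r,
  which shifts b by one.\<close>

definition gamma_kernel :: "real \<Rightarrow> real \<Rightarrow> real \<Rightarrow> real" where
  "gamma_kernel b x r = r powr b * exp (- (x * r))"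

lemma gamma_kernel_nonneg: "0 \<le> gamma_kernel b x r"
  by (simp add: gamma_kernel_def)

text \<open>Uniformity in r lets a constant multiple of \<open>dens\<close> dominate all mixtures
  and their derivatives.\<close>

lemma gamma_kernel_le: "0 < x0 \<Longrightarrow> x0 \<le> x \<Longrightarrow> 0 < b \<Longrightarrow> 0 \<le> r \<Longrightarrow> gamma_kernel b x r \<le> (b / x0) powr b"
proof -
  assume a: "0 < x0" "x0 \<le> x" "0 < b" "0 \<le> r"
  have "gamma_kernel b x r \<le> r powr b * exp (- (x0 * r))"
    unfolding gamma_kernel_def using a by (intro mult_left_mono) (auto intro: mult_right_mono)
  also have "\<dots> \<le> (b / x0) powr b"
    using a by (intro powr_times_exp_le)
  finally show ?thesis .
qed

lemma gamma_kernel_Suc: "0 \<le> r \<Longrightarrow> gamma_kernel (b + 1) x r = r * gamma_kernel b x r"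
  by (simp add: gamma_kernel_def powr_add)

lemma gamma_kernel_deriv_x: "0 \<le> r \<Longrightarrow> ((\<lambda>x. gamma_kernel b x r) has_real_derivative - gamma_kernel (b + 1) x r) (at x)"
  unfolding gamma_kernel_Suc unfolding gamma_kernel_def
  by (auto intro!: derivative_eq_intros)

lemma gamma_kernel_deriv_r:
  "0 < r \<Longrightarrow> (gamma_kernel b x has_real_derivative (b * gamma_kernel b x r - x * gamma_kernel (b + 1) x r) / r) (at r)"
  unfolding gamma_kernel_Suc[OF less_imp_le] unfolding gamma_kernel_def
  by (auto intro!: derivative_eq_intros simp: powr_diff field_simps)

lemma gamma_kernel_measurable [measurable]:
  assumes [measurable]: "f \<in> borel_measurable M"
  shows "(\<lambda>z. gamma_kernel b x (f z)) \<in> borel_measurable M"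
  unfolding gamma_kernel_def by measurable

lemma g_tilde_eq_gamma_kernel:
  assumes "0 < s"
  shows "g_tilde \<mu> x s = x powr (\<mu> - 1) / Gamma \<mu> * gamma_kernel \<mu> x (1 / s)"
  using assms by (simp add: g_tilde_def gamma_kernel_def powr_divide)

context stable_density
begin

text \<open>The V_b of the overview. As \<open>dens\<close> vanishes for z \<le> 0, the values of
  \<open>powr\<close> at negative bases do not enter.\<close>

definition mix :: "real \<Rightarrow> real \<Rightarrow> real \<Rightarrow> real" where
  "mix b x t = (\<integral>z. gamma_kernel b x ((z / t) powr \<nu>) * dens z \<partial>lborel)"

lemma mix_integrable:
  assumes "0 < b" "0 < x"
  shows "integrable lborel (\<lambda>z. gamma_kernel b x ((z / t) powr \<nu>) * dens z)"
proof (rule Bochner_Integration.integrable_bound)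
  show "integrable lborel (\<lambda>z. (b / x) powr b * dens z)"
    using dens_integrable by simp
  show "AE z in lborel. norm (gamma_kernel b x ((z / t) powr \<nu>) * dens z) \<le> norm ((b / x) powr b * dens z)"
    using gamma_kernel_le[OF assms(2) order_refl assms(1)] gamma_kernel_nonneg dens_nonneg
    by (intro AE_I2) (auto simp: abs_mult intro!: mult_right_mono)
qed measurable

lemma mix_nonneg: "0 \<le> mix b x t"
  unfolding mix_def using gamma_kernel_nonneg dens_nonneg by (intro integral_nonneg_AE) auto

lemma nn_mix:
  assumes "0 < b" "0 < x"
  shows "(\<integral>\<^sup>+z. ennreal (gamma_kernel b x ((z / t) powr \<nu>) * dens z) \<partial>lborel) = ennreal (mix b x t)"
  unfolding mix_def using gamma_kernel_nonneg dens_nonneg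
  by (intro nn_integral_eq_integral mix_integrable assms) auto

lemma mix_measurable [measurable]: "(\<lambda>t. mix b x t) \<in> borel_measurable borel"
  unfolding mix_def[abs_def] gamma_kernel_def by measurable

lemma mix_deriv_x:
  assumes b: "0 < b" and x: "0 < x"
  shows "((\<lambda>x. mix b x t) has_real_derivative - mix (b + 1) x t) (at x)"
proof -
  have "((\<lambda>x. mix b x t) has_real_derivative (\<integral>z. - (gamma_kernel (b + 1) x ((z / t) powr \<nu>) * dens z) \<partial>lborel)) (at x)"
    unfolding mix_def
  proof (rule has_real_derivative_integral(1)[where a = "x / 2" and b = "2 * x"])
    show "((\<lambda>x. gamma_kernel b x ((z / t) powr \<nu>) * dens z) has_real_derivative - (gamma_kernel (b + 1) p ((z / t) powr \<nu>) * dens z)) (at p)" for p z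
      using DERIV_cmult_right[OF gamma_kernel_deriv_x[of "(z / t) powr \<nu>" b p], of "dens z"] by simp
    show "\<bar>- (gamma_kernel (b + 1) p ((z / t) powr \<nu>) * dens z)\<bar> \<le> ((b + 1) / (x / 2)) powr (b + 1) * dens z"
      if "p \<in> {x / 2<..<2 * x}" for p z
      using gamma_kernel_le[of "x / 2" p "b + 1" "(z / t) powr \<nu>"] that b x gamma_kernel_nonneg dens_nonneg
      by (auto simp: abs_mult intro!: mult_right_mono)
  qed (use b x dens_integrable mix_integrable in auto)
  then show ?thesis
    by (simp add: mix_def)
qed

text \<open>The argument r = (z / t)^\<nu> satisfies dr/dt = - (\<nu> / t) r, and this r cancels the
  1 / r in \<open>gamma_kernel_deriv_r\<close>; what is left is a combination of kernels with
  indices b and b + 1.\<close>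

lemma mix_deriv_t:
  assumes b: "0 < b" and x: "0 < x" and t: "0 < t"
  shows "(mix b x has_real_derivative - (\<nu> / t) * (b * mix b x t - x * mix (b + 1) x t)) (at t)"
proof -
  define K' where "K' = (\<lambda>t z. - (\<nu> / t) * (b * (gamma_kernel b x ((z / t) powr \<nu>) * dens z)
    - x * (gamma_kernel (b + 1) x ((z / t) powr \<nu>) * dens z)))"
  define C where "C = b * (b / x) powr b + x * ((b + 1) / x) powr (b + 1)"
  have "(mix b x has_real_derivative (\<integral>z. K' t z \<partial>lborel)) (at t)"
    unfolding mix_def[abs_def]
  proof (rule has_real_derivative_integral(1)[where a = "t / 2" and b = "2 * t"])
    fix p z assume "p \<in> {t / 2<..<2 * t}"
    then have p: "0 < p" "t / 2 < p" using t by auto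
    show "((\<lambda>t. gamma_kernel b x ((z / t) powr \<nu>) * dens z) has_real_derivative K' p z) (at p)"
    proof (cases "0 < z")
      case True
      define r where "r = (z / p) powr \<nu>"
      have r: "0 < r" using True p by (simp add: r_def)
      have "((\<lambda>t. (z / t) powr \<nu>) has_real_derivative - (\<nu> / p) * r) (at p)"
        unfolding r_def using True p
        by (auto intro!: derivative_eq_intros simp: powr_diff field_simps power2_eq_square)
      from DERIV_cmult_right[OF DERIV_chain2[OF gamma_kernel_deriv_r[OF r, unfolded r_def] this], of b x "dens z"]
      moreover have "(b * gamma_kernel b x r - x * gamma_kernel (b + 1) x r) / r * (- (\<nu> / p) * r) * dens z = K' p z"
        unfolding K'_def r_def[symmetric] using r by simp (simp add: algebra_simps)
      ultimately show ?thesis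
        by (simp only: r_def)
    qed (simp add: K'_def dens_def)
    have "\<bar>K' p z\<bar> \<le> 2 * \<nu> / t * (C * dens z)"
    proof -
      let ?g = "\<lambda>b. gamma_kernel b x ((z / p) powr \<nu>)"
      have g: "?g b \<le> (b / x) powr b" "?g (b + 1) \<le> ((b + 1) / x) powr (b + 1)"
        using b x by (auto intro!: gamma_kernel_le)
      have "\<bar>b * ?g b - x * ?g (b + 1)\<bar> \<le> b * ?g b + x * ?g (b + 1)"
        using b x gamma_kernel_nonneg by (auto simp: abs_le_iff intro: mult_nonneg_nonneg)
      also have "\<dots> \<le> C"
        unfolding C_def using b x g by (intro add_mono mult_left_mono) auto
      finally have 1: "\<bar>b * ?g b - x * ?g (b + 1)\<bar> * dens z \<le> C * dens z"
        using dens_nonneg by (rule mult_right_mono)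
      have 2: "\<nu> / p \<le> 2 * \<nu> / t"
        using p t \<nu> by (simp add: field_simps)
      have "\<nu> / p * (\<bar>b * ?g b - x * ?g (b + 1)\<bar> * dens z) \<le> 2 * \<nu> / t * (C * dens z)"
        by (rule mult_mono[OF 2 1]) (use t \<nu> dens_nonneg in auto)
      also have "\<nu> / p * (\<bar>b * ?g b - x * ?g (b + 1)\<bar> * dens z) = \<bar>- (\<nu> / p) * ((b * ?g b - x * ?g (b + 1)) * dens z)\<bar>"
        using p \<nu> dens_nonneg by (simp only: abs_mult abs_minus) simp
      also have "- (\<nu> / p) * ((b * ?g b - x * ?g (b + 1)) * dens z) = K' p z"
        by (simp add: K'_def algebra_simps)
      finally show ?thesis .
    qed
    then show "\<bar>K' p z\<bar> \<le> 2 * \<nu> / t * (C * dens z)" .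
  qed (use b x t dens_integrable mix_integrable in auto)
  also have "(\<integral>z. K' t z \<partial>lborel) = - (\<nu> / t) * (b * mix b x t - x * mix (b + 1) x t)"
    unfolding K'_def mix_def using mix_integrable[of _ x t] b x by simp
  finally show ?thesis .
qed

text \<open>The substitution z = v y frees the kernel from y and cancels the singular 1 / y: (1 / y)
  V_b(y) is the integral of \<open>\<phi> v\<close> times \<open>dens (v * y)\<close>. After Tonelli
  the inner integral over y is an Abel integral of the density, which \<open>abel_identity\<close>
  evaluates at t v. The result carries v^\<nu>, which raises b to b + 1.\<close>

lemma mix_abel_nn:
  assumes b: "0 < b" and x: "0 < x" and t: "0 < t"
  shows "(\<integral>\<^sup>+y. ennreal (if 0 < y \<and> y < t then (t - y) powr (- \<nu>) * (\<nu> / y * mix b x y) else 0) \<partial>lborel)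
    = ennreal (Gamma (1 - \<nu>) * mix (b + 1) x t)"
proof -
  define \<phi> where "\<phi> = (\<lambda>v. gamma_kernel b x (v powr \<nu>))"
  have \<phi>: "0 \<le> \<phi> v" for v by (simp add: \<phi>_def gamma_kernel_nonneg)
  have [measurable]: "\<phi> \<in> borel_measurable borel"
    unfolding \<phi>_def by measurable
  have dens0: "dens w = 0" if "w \<le> 0" for w
    using that by (simp add: dens_def)
  have G: "0 < Gamma (1 - \<nu>)"
    using \<nu> by (simp add: Gamma_real_pos)
  have A: "ennreal (if 0 < y \<and> y < t then (t - y) powr (- \<nu>) * (\<nu> / y * mix b x y) else 0)
      = (\<integral>\<^sup>+v. ennreal (if 0 < v then \<nu> * \<phi> v else 0) * ennreal (if y < t then (t - y) powr (- \<nu>) * dens (v * y) else 0) \<partial>lborel)" for y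
  proof (cases "0 < y \<and> y < t")
    case True
    have "ennreal (mix b x y) = ennreal \<bar>y\<bar> * (\<integral>\<^sup>+v. ennreal (gamma_kernel b x (((0 + y * v) / y) powr \<nu>) * dens (0 + y * v)) \<partial>lborel)"
      unfolding nn_mix[OF b x, symmetric] by (rule nn_integral_real_affine) (use True in auto)
    then have m: "ennreal (mix b x y) = ennreal y * (\<integral>\<^sup>+v. ennreal (\<phi> v * dens (v * y)) \<partial>lborel)"
      using True by (simp add: \<phi>_def mult.commute)
    have "ennreal ((t - y) powr (- \<nu>) * (\<nu> / y * mix b x y)) = ennreal ((t - y) powr (- \<nu>) * (\<nu> / y)) * ennreal (mix b x y)"
      using True \<nu> mix_nonneg by (simp add: mult.assoc flip: ennreal_mult)
    also have "\<dots> = ennreal ((t - y) powr (- \<nu>) * (\<nu> / y)) * ennreal y * (\<integral>\<^sup>+v. ennreal (\<phi> v * dens (v * y)) \<partial>lborel)"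
      unfolding m by (simp add: mult.assoc)
    also have "ennreal ((t - y) powr (- \<nu>) * (\<nu> / y)) * ennreal y = ennreal ((t - y) powr (- \<nu>) * \<nu>)"
      using True \<nu> by (simp flip: ennreal_mult)
    also have "ennreal ((t - y) powr (- \<nu>) * \<nu>) * (\<integral>\<^sup>+v. ennreal (\<phi> v * dens (v * y)) \<partial>lborel)
        = (\<integral>\<^sup>+v. ennreal ((t - y) powr (- \<nu>) * \<nu>) * ennreal (\<phi> v * dens (v * y)) \<partial>lborel)"
      by (rule nn_integral_cmult[symmetric]) measurable
    also have "\<dots> = (\<integral>\<^sup>+v. ennreal (if 0 < v then \<nu> * \<phi> v else 0) * ennreal (if y < t then (t - y) powr (- \<nu>) * dens (v * y) else 0) \<partial>lborel)"
    proof (rule nn_integral_cong)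
      fix v
      have "dens (v * y) = 0" if "\<not> 0 < v"
        using that True by (intro dens0) (simp add: mult_le_0_iff)
      then show "ennreal ((t - y) powr (- \<nu>) * \<nu>) * ennreal (\<phi> v * dens (v * y))
        = ennreal (if 0 < v then \<nu> * \<phi> v else 0) * ennreal (if y < t then (t - y) powr (- \<nu>) * dens (v * y) else 0)"
        using True \<nu> \<phi>[of v] dens_nonneg[of "v * y"] by (auto simp: mult_ac simp flip: ennreal_mult)
    qed
    finally show ?thesis
      using True by simp
  next
    case False
    have "ennreal (if 0 < v then \<nu> * \<phi> v else 0) * ennreal (if y < t then (t - y) powr (- \<nu>) * dens (v * y) else 0) = 0" for v
    proof (cases "0 < v \<and> y < t")
      case True
      with False have "dens (v * y) = 0"
        by (intro dens0) (simp add: mult_le_0_iff)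
      then show ?thesis by simp
    qed auto
    note zero = this
    show ?thesis
      unfolding zero using False by auto
  qed
  \<comment> \<open>An almost everywhere identity suffices under the outer integral and is preserved
    by the scaling. The form \<open>0 + t * v\<close> is that of the affine substitution
    rule.\<close>
  have "AE v in lborel. 0 < 0 + t * v \<longrightarrow>
    (\<integral>\<^sup>+w. ennreal (if w < 0 + t * v then (0 + t * v - w) powr (- \<nu>) * dens w else 0) \<partial>lborel)
      = ennreal (Gamma (1 - \<nu>) / \<nu> * kern 0 (0 + t * v))"
    using t by (intro AE_borel_affine[OF _ _ abel_identity]) auto
  then have "AE v in lborel. 0 < t * v \<longrightarrow>
    (\<integral>\<^sup>+w. ennreal (if w < t * v then (t * v - w) powr (- \<nu>) * dens w else 0) \<partial>lborel)
      = ennreal (Gamma (1 - \<nu>) / \<nu> * kern 0 (t * v))"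
    by (simp only: add_0)
  then have B: "AE v in lborel. (if 0 < v then \<nu> * \<phi> v else 0) * (\<integral>\<^sup>+y. ennreal (if y < t then (t - y) powr (- \<nu>) * dens (v * y) else 0) \<partial>lborel)
      = ennreal (Gamma (1 - \<nu>) * t) * ennreal (gamma_kernel (b + 1) x (((0 + t * v) / t) powr \<nu>) * dens (0 + t * v))"
  proof eventually_elim
    case (elim v)
    show ?case
    proof (cases "0 < v")
      case True
      have tv: "0 < t * v" using True t by simp
      have "(\<integral>\<^sup>+y. ennreal (if y < t then (t - y) powr (- \<nu>) * dens (v * y) else 0) \<partial>lborel)
          = ennreal \<bar>1 / v\<bar> * (\<integral>\<^sup>+w. ennreal (if 0 + 1 / v * w < t then (t - (0 + 1 / v * w)) powr (- \<nu>) * dens (v * (0 + 1 / v * w)) else 0) \<partial>lborel)"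
        by (rule nn_integral_real_affine) (use True in auto)
      also have "\<dots> = ennreal (1 / v) * (\<integral>\<^sup>+w. ennreal (v powr \<nu>) * ennreal (if w < t * v then (t * v - w) powr (- \<nu>) * dens w else 0) \<partial>lborel)"
      proof (intro arg_cong2[where f = times] nn_integral_cong)
        fix w
        have "(t - w / v) powr (- \<nu>) = v powr \<nu> * (t * v - w) powr (- \<nu>)" if "w < t * v"
        proof -
          have "t - w / v = (t * v - w) / v"
            using True by (simp add: field_simps)
          then show ?thesis
            using True that by (simp add: powr_divide powr_minus field_simps)
        qed
        then show "ennreal (if 0 + 1 / v * w < t then (t - (0 + 1 / v * w)) powr (- \<nu>) * dens (v * (0 + 1 / v * w)) else 0)
          = ennreal (v powr \<nu>) * ennreal (if w < t * v then (t * v - w) powr (- \<nu>) * dens w else 0)"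
          using True dens_nonneg[of w] by (auto simp: pos_divide_less_eq mult.assoc simp flip: ennreal_mult)
      qed (use True in simp)
      also have "\<dots> = ennreal (1 / v) * (ennreal (v powr \<nu>) * ennreal (Gamma (1 - \<nu>) / \<nu> * kern 0 (t * v)))"
        using elim tv by (subst nn_integral_cmult) auto
      \<comment> \<open>The factor v cancels the Jacobian 1 / v, and t is the Jacobian of the return
        to z = t v.\<close>
      also have "kern 0 (t * v) = t * v * dens (t * v)"
        using dens_eq_kern[OF tv] True t by simp
      finally have "(\<integral>\<^sup>+y. ennreal (if y < t then (t - y) powr (- \<nu>) * dens (v * y) else 0) \<partial>lborel)
          = ennreal (v powr \<nu> * (Gamma (1 - \<nu>) / \<nu> * t * dens (t * v)))"
        using True t \<nu> G dens_nonneg[of "t * v"] by (simp flip: ennreal_mult)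
      then show ?thesis
        using True t \<nu> G dens_nonneg[of "t * v"] \<phi>[of v]
        by (simp add: gamma_kernel_Suc \<phi>_def gamma_kernel_nonneg mult_ac flip: ennreal_mult)
    next
      case False
      then have "dens (0 + t * v) = 0"
        using t by (intro dens0) (simp add: mult_le_0_iff)
      then show ?thesis
        using False by simp
    qed
  qed
  have "(\<integral>\<^sup>+y. ennreal (if 0 < y \<and> y < t then (t - y) powr (- \<nu>) * (\<nu> / y * mix b x y) else 0) \<partial>lborel)
    = (\<integral>\<^sup>+y. \<integral>\<^sup>+v. ennreal (if 0 < v then \<nu> * \<phi> v else 0) * ennreal (if y < t then (t - y) powr (- \<nu>) * dens (v * y) else 0) \<partial>lborel \<partial>lborel)"
    unfolding A ..
  also have "\<dots> = (\<integral>\<^sup>+v. \<integral>\<^sup>+y. ennreal (if 0 < v then \<nu> * \<phi> v else 0) * ennreal (if y < t then (t - y) powr (- \<nu>) * dens (v * y) else 0) \<partial>lborel \<partial>lborel)"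
    by (rule lborel_pair.Fubini') measurable
  also have "\<dots> = (\<integral>\<^sup>+v. (if 0 < v then \<nu> * \<phi> v else 0) * (\<integral>\<^sup>+y. ennreal (if y < t then (t - y) powr (- \<nu>) * dens (v * y) else 0) \<partial>lborel) \<partial>lborel)"
    by (intro nn_integral_cong nn_integral_cmult) measurable
  also have "\<dots> = (\<integral>\<^sup>+v. ennreal (Gamma (1 - \<nu>) * t) * ennreal (gamma_kernel (b + 1) x (((0 + t * v) / t) powr \<nu>) * dens (0 + t * v)) \<partial>lborel)"
    by (rule nn_integral_cong_AE[OF B])
  also have "\<dots> = ennreal (Gamma (1 - \<nu>)) * (ennreal \<bar>t\<bar> * (\<integral>\<^sup>+v. ennreal (gamma_kernel (b + 1) x (((0 + t * v) / t) powr \<nu>) * dens (0 + t * v)) \<partial>lborel))"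
    using t G by (subst nn_integral_cmult) (auto simp: ennreal_mult mult.assoc)
  also have "ennreal \<bar>t\<bar> * (\<integral>\<^sup>+v. ennreal (gamma_kernel (b + 1) x (((0 + t * v) / t) powr \<nu>) * dens (0 + t * v)) \<partial>lborel)
    = ennreal (mix (b + 1) x t)"
    unfolding nn_mix[of "b + 1", OF add_pos_pos[OF b zero_less_one] x, symmetric]
    by (rule nn_integral_real_affine[symmetric]) (use t in auto)
  finally show ?thesis
    using G by (simp add: ennreal_mult mix_nonneg)
qed

lemma mix_abel:
  assumes b: "0 < b" and x: "0 < x" and t: "0 < t"
  shows "set_integrable lborel {0<..<t} (\<lambda>y. (t - y) powr (- \<nu>) * (\<nu> / y * mix b x y))"
    and "(LINT y:{0<..<t}|lborel. (t - y) powr (- \<nu>) * (\<nu> / y * mix b x y)) = Gamma (1 - \<nu>) * mix (b + 1) x t"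
proof -
  have eq: "(if 0 < y \<and> y < t then (t - y) powr (- \<nu>) * (\<nu> / y * mix b x y) else 0)
      = indicator {0<..<t} y *\<^sub>R ((t - y) powr (- \<nu>) * (\<nu> / y * mix b x y))" for y
    by simp
  have G: "0 < Gamma (1 - \<nu>)"
    using \<nu> by (simp add: Gamma_real_pos)
  have "has_bochner_integral lborel (\<lambda>y. indicator {0<..<t} y *\<^sub>R ((t - y) powr (- \<nu>) * (\<nu> / y * mix b x y))) (Gamma (1 - \<nu>) * mix (b + 1) x t)"
    using mix_abel_nn[OF assms] \<nu> mix_nonneg G unfolding eq
    by (intro has_bochner_integral_nn_integral) (auto intro!: AE_I2 simp: indicator_def)
  then show "set_integrable lborel {0<..<t} (\<lambda>y. (t - y) powr (- \<nu>) * (\<nu> / y * mix b x y))"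
    "(LINT y:{0<..<t}|lborel. (t - y) powr (- \<nu>) * (\<nu> / y * mix b x y)) = Gamma (1 - \<nu>) * mix (b + 1) x t"
    unfolding set_integrable_def set_lebesgue_integral_def has_bochner_integral_iff by auto
qed

text \<open>The substitution \<open>s = (t / z)\<^bsup>\<nu>\<^esup>\<close> expresses that the inverse process at time \<open>t\<close>
  has the law of \<open>(t / \<tau>\<^sub>1)\<^bsup>\<nu>\<^esup>\<close>.\<close>

lemma u_tilde_eq_mix:
  assumes \<mu>: "0 < \<mu>" and x: "0 < x" and t: "0 < t"
  shows "u_tilde h \<mu> \<nu> x t = x powr (\<mu> - 1) / Gamma \<mu> * mix \<mu> x t"
proof -
  define F where "F = (\<lambda>s. gamma_kernel \<mu> x (1 / s) * (kern 0 (t * s powr (- 1 / \<nu>)) / (\<nu> * s)))"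
  define g where "g = (\<lambda>z. (t / z) powr \<nu>)"
  have F_meas [measurable]: "F \<in> borel_measurable borel"
    unfolding F_def by measurable
  have image: "g ` {0<..} = {0<..}"
  proof (intro equalityI subsetI)
    fix s :: real assume s: "s \<in> {0<..}"
    have "t / (t * s powr (- 1 / \<nu>)) = s powr (1 / \<nu>)"
      using s t by (simp add: powr_minus field_simps)
    then have "g (t * s powr (- 1 / \<nu>)) = s"
      using s t \<nu> by (simp add: g_def powr_powr)
    with s t show "s \<in> g ` {0<..}"
      by (intro image_eqI[where x = "t * s powr (- 1 / \<nu>)"]) auto
  qed (use t in \<open>auto simp: g_def\<close>)
  have inv: "t * g z powr (- 1 / \<nu>) = z" if "0 < z" for z
    using that t \<nu> by (simp add: g_def powr_powr powr_minus_divide)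
  \<comment> \<open>The Jacobian (\<nu> / z) g(z) cancels the 1 / (\<nu> s) of the inverse density
    at s = g(z), and \<open>kern 0 z / z\<close> is the density at time one.\<close>
  have jac: "\<bar>- (\<nu> / z) * g z\<bar> * F (g z) = gamma_kernel \<mu> x ((z / t) powr \<nu>) * dens z" if z: "0 < z" for z
  proof -
    have "0 < g z" using z t by (simp add: g_def)
    moreover have "1 / g z = (z / t) powr \<nu>"
      using z t by (simp add: g_def powr_divide)
    ultimately show ?thesis
      unfolding F_def inv[OF z] using z \<nu> by (simp add: dens_eq_kern abs_mult)
  qed
  have lhs: "(\<lambda>z. \<bar>- (\<nu> / z) * g z\<bar> * F (g z)) absolutely_integrable_on {0<..} \<and>
      integral {0<..} (\<lambda>z. \<bar>- (\<nu> / z) * g z\<bar> * F (g z)) = mix \<mu> x t"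
  proof -
    have eq: "indicator {0<..} z *\<^sub>R (\<bar>- (\<nu> / z) * g z\<bar> * F (g z)) = gamma_kernel \<mu> x ((z / t) powr \<nu>) * dens z" for z
    proof (cases "0 < z")
      case True
      then show ?thesis unfolding jac[OF True] by simp
    qed (simp add: dens_def)
    have i: "set_integrable lborel {0<..} (\<lambda>z. \<bar>- (\<nu> / z) * g z\<bar> * F (g z))"
      unfolding set_integrable_def eq by (rule mix_integrable[OF \<mu> x])
    \<comment> \<open>The change of variables theorem speaks of the completed Lebesgue measure;
      Borel measurability of the integrand allows passing there and back.\<close>
    have "(\<lambda>z. \<bar>- (\<nu> / z) * g z\<bar> * F (g z)) absolutely_integrable_on {0<..}"
      using i unfolding set_integrable_def by (subst integrable_completion) auto
    moreover have "integral {0<..} (\<lambda>z. \<bar>- (\<nu> / z) * g z\<bar> * F (g z)) = mix \<mu> x t"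
      using set_borel_integral_eq_integral(2)[OF i] unfolding set_lebesgue_integral_def eq mix_def by simp
    ultimately show ?thesis ..
  qed
  have "(\<lambda>z. \<bar>- (\<nu> / z) * g z\<bar> * F (g z)) absolutely_integrable_on {0<..} \<and>
      integral {0<..} (\<lambda>z. \<bar>- (\<nu> / z) * g z\<bar> * F (g z)) = mix \<mu> x t
      \<longleftrightarrow> F absolutely_integrable_on (g ` {0<..}) \<and> integral (g ` {0<..}) F = mix \<mu> x t"
  proof (rule has_absolute_integral_change_of_variables_1')
    show "inj_on g {0<..}"
      by (rule inj_onI) (metis inv greaterThan_iff)
    show "(g has_field_derivative - (\<nu> / z) * g z) (at z within {0<..})" if "z \<in> {0<..}" for z
      unfolding g_def using that t
      by (auto intro!: derivative_eq_intros simp: powr_diff field_simps power2_eq_square)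
  qed simp
  with lhs have "F absolutely_integrable_on {0<..}" and I: "integral {0<..} F = mix \<mu> x t"
    by (auto simp: image)
  then have "set_integrable lborel {0<..} F"
    unfolding set_integrable_def by (subst (asm) integrable_completion) auto
  then have "(LINT s:{0<..}|lborel. F s) = mix \<mu> x t"
    using I by (simp add: set_borel_integral_eq_integral(2))
  moreover have "(LINT s:{0<..}|lborel. g_tilde \<mu> x s * inverse_density h s t)
      = (LINT s:{0<..}|lborel. x powr (\<mu> - 1) / Gamma \<mu> * F s)"
    by (rule set_lebesgue_integral_cong)
      (use t in \<open>auto simp: g_tilde_eq_gamma_kernel inverse_density_eq F_def\<close>)
  ultimately show ?thesis
    using \<nu> by (simp add: u_tilde_def)
qed

end

section \<open>From the subordinator to the equation, and the case \<nu> = 1\<close>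

lemma (in stable_subordinator) stable_density:
  assumes h: "density_of_subordinator M \<tau> h"
  shows "stable_density \<nu> h"
proof (intro stable_density.intro stable_index.intro stable_density_axioms.intro index)
  fix t :: real assume t: "0 < t"
  define f where "f = (\<lambda>x. indicator {0<..} x * h x t)"
  show cont: "continuous_on {0<..} (\<lambda>x. h x t)"
    using h t by (simp add: density_of_subordinator_def)
  show nonneg: "0 \<le> h x t" if "0 < x" for x
    using h t that by (simp add: density_of_subordinator_def)
  have f0: "0 \<le> f x" for x
    using nonneg by (auto simp: f_def indicator_def)
  have [measurable]: "f \<in> borel_measurable borel"
    using borel_measurable_continuous_on_indicator[OF _ cont] by (simp add: f_def)
  have "(\<lambda>x. ennreal (h x t) * indicator {0<..} x) = (\<lambda>x. ennreal (f x))"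
    by (auto simp: f_def fun_eq_iff indicator_def)
  then have D: "distributed M lborel (\<tau> t) (\<lambda>x. ennreal (f x))"
    using h t unfolding density_of_subordinator_def by metis
  have "(\<integral>\<^sup>+x. ennreal (f x) \<partial>lborel) = 1"
    using distributed_nn_integral[OF D, of "\<lambda>_. 1"] by (simp add: emeasure_space_1)
  then have "integrable lborel f"
    using f0 by (intro integrableI_nonneg) auto
  then show "set_integrable lborel {0<..} (\<lambda>x. h x t)"
    by (simp add: set_integrable_def f_def)
  fix q :: real assume q: "0 < q"
  have "(LINT x:{0<..}|lborel. exp (- q * x) * h x t) = (\<integral>x. f x * exp (- q * x) \<partial>lborel)"
    unfolding set_lebesgue_integral_def f_def by (simp add: mult_ac)
  also have "\<dots> = expectation (\<lambda>\<omega>. exp (- q * \<tau> t \<omega>))"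
    by (rule distributed_integral[OF D]) (use f0 in auto)
  also have "\<dots> = exp (- t * q powr \<nu>)"
    using laplace t q by simp
  finally show "(LINT x:{0<..}|lborel. exp (- q * x) * h x t) = exp (- t * q powr \<nu>)" .
qed

text \<open>The witnesses come from the product rule for w(x) times the mixture. The time derivative
  is a combination of (\<nu> / s) \<open>mix\<close> at indices \<mu> and \<mu> + 1, and
  \<open>mix_abel\<close> integrates each term separately.\<close>

lemma (in stable_density) u_tilde_fractional_equation:
  assumes \<mu>: "0 < \<mu>"
  shows "\<exists>ux uxx. \<forall>x>0. \<forall>t>0.
    ((\<lambda>y. u_tilde h \<mu> \<nu> y t) has_real_derivative ux x t) (at x) \<and>
    ((\<lambda>y. ux y t) has_real_derivative uxx x t) (at x) \<and>
    has_caputo_derivative \<nu> (\<lambda>r. u_tilde h \<mu> \<nu> x r) (x * uxx x t - (\<mu> - 2) * ux x t) t"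
proof -
  define w where "w = (\<lambda>x. x powr (\<mu> - 1) / Gamma \<mu>)"
  define ux where "ux = (\<lambda>x t. w x * ((\<mu> - 1) / x * mix \<mu> x t - mix (\<mu> + 1) x t))"
  define uxx where "uxx = (\<lambda>x t. w x * ((\<mu> - 1) * (\<mu> - 2) / x\<^sup>2 * mix \<mu> x t
    - 2 * (\<mu> - 1) / x * mix (\<mu> + 1) x t + mix (\<mu> + 2) x t))"
  have dw: "(w has_real_derivative (\<mu> - 1) / x * w x) (at x)" if "0 < x" for x
    unfolding w_def
    by (rule DERIV_cong[OF DERIV_cdivide[OF has_real_derivative_powr[OF that]]])
      (use that in \<open>simp add: powr_diff power2_eq_square\<close>)
  have mix2: "mix (\<mu> + 1 + 1) x t = mix (\<mu> + 2) x t" for x t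
    by (simp add: add.assoc)
  have dx: "((\<lambda>y. u_tilde h \<mu> \<nu> y t) has_real_derivative ux x t) (at x)" if "0 < x" "0 < t" for x t
  proof (rule has_field_derivative_transform_within_open[of "\<lambda>y. w y * mix \<mu> y t" _ _ "{0<..}"])
    show "((\<lambda>y. w y * mix \<mu> y t) has_real_derivative ux x t) (at x)"
      by (rule DERIV_cong[OF DERIV_mult[OF dw mix_deriv_x]])
        (use that \<mu> in \<open>auto simp: ux_def algebra_simps\<close>)
  qed (use that u_tilde_eq_mix[OF \<mu>] in \<open>auto simp: w_def\<close>)
  have dxx: "((\<lambda>y. ux y t) has_real_derivative uxx x t) (at x)" if "0 < x" for x t
  proof -
    have "((\<lambda>y. (\<mu> - 1) / y * mix \<mu> y t - mix (\<mu> + 1) y t) has_real_derivative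
       - (\<mu> - 1) / x\<^sup>2 * mix \<mu> x t + - mix (\<mu> + 1) x t * ((\<mu> - 1) / x) - - mix (\<mu> + 1 + 1) x t) (at x)"
      using that \<mu>
      by (intro DERIV_diff DERIV_mult mix_deriv_x) (auto intro!: derivative_eq_intros simp: power2_eq_square)
    from DERIV_mult[OF dw[OF that] this] show ?thesis
      unfolding ux_def
      by (rule DERIV_cong) (use that in \<open>simp add: uxx_def mix2 field_simps power2_eq_square\<close>)
  qed
  have caputo: "has_caputo_derivative \<nu> (\<lambda>r. u_tilde h \<mu> \<nu> x r) (x * uxx x t - (\<mu> - 2) * ux x t) t"
    if x: "0 < x" and t: "0 < t" for x t
  proof -
    define du where "du = (\<lambda>s. w x * (- (\<nu> / s) * (\<mu> * mix \<mu> x s - x * mix (\<mu> + 1) x s)))"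
    have dt: "((\<lambda>r. u_tilde h \<mu> \<nu> x r) has_real_derivative du s) (at s)" if s: "0 < s" for s
    proof (rule has_field_derivative_transform_within_open[of "\<lambda>r. w x * mix \<mu> x r" _ _ "{0<..}"])
      show "((\<lambda>r. w x * mix \<mu> x r) has_real_derivative du s) (at s)"
        unfolding du_def by (intro DERIV_cmult mix_deriv_t \<mu> x s)
    qed (use s u_tilde_eq_mix[OF \<mu> x] in \<open>auto simp: w_def\<close>)
    define k where "k = (\<lambda>b s. (t - s) powr (- \<nu>) * (\<nu> / s * mix b x s))"
    have G: "0 < Gamma (1 - \<nu>)"
      using \<nu> by (simp add: Gamma_real_pos)
    have k: "set_integrable lborel {0<..<t} (k b)" "(LINT s:{0<..<t}|lborel. k b s) = Gamma (1 - \<nu>) * mix (b + 1) x t"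
      if "0 < b" for b
      unfolding k_def by (rule mix_abel[OF that x t])+
    have kk: "set_integrable lborel {0<..<t} (\<lambda>s. w x * x * k (\<mu> + 1) s)" "set_integrable lborel {0<..<t} (\<lambda>s. w x * \<mu> * k \<mu> s)"
      using k \<mu> by (auto intro!: set_integrable_mult_right)
    have eq: "(t - s) powr (- \<nu>) * deriv (\<lambda>r. u_tilde h \<mu> \<nu> x r) s = w x * x * k (\<mu> + 1) s - w x * \<mu> * k \<mu> s"
      if "s \<in> {0<..<t}" for s
    proof -
      have deriv: "deriv (\<lambda>r. u_tilde h \<mu> \<nu> x r) s = du s"
        using that by (intro DERIV_imp_deriv dt) auto
      show ?thesis
        unfolding deriv by (simp add: du_def k_def algebra_simps)
    qed
    have int: "set_integrable lborel {0<..<t} (\<lambda>s. (t - s) powr (- \<nu>) * deriv (\<lambda>r. u_tilde h \<mu> \<nu> x r) s)"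
      using set_integral_diff(1)[OF kk] by (subst set_integrable_cong[OF refl refl eq])
    have "(LINT s:{0<..<t}|lborel. (t - s) powr (- \<nu>) * deriv (\<lambda>r. u_tilde h \<mu> \<nu> x r) s)
        = (LINT s:{0<..<t}|lborel. w x * x * k (\<mu> + 1) s - w x * \<mu> * k \<mu> s)"
      by (rule set_lebesgue_integral_cong) (use eq in auto)
    also have "\<dots> = w x * x * (Gamma (1 - \<nu>) * mix (\<mu> + 1 + 1) x t) - w x * \<mu> * (Gamma (1 - \<nu>) * mix (\<mu> + 1) x t)"
      using set_integral_diff(2)[OF kk] k(2) \<mu> by simp
    also have "\<dots> = Gamma (1 - \<nu>) * (w x * (x * mix (\<mu> + 2) x t - \<mu> * mix (\<mu> + 1) x t))"
      by (simp add: mix2 algebra_simps)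
    \<comment> \<open>The coefficient \<mu> - 2 makes the terms with \<open>mix \<mu>\<close>
      cancel, as (\<mu> - 1)(\<mu> - 2) / x occurs with both signs; at index \<mu> + 1, -2 (\<mu> -
      1) + (\<mu> - 2) leaves - \<mu>.\<close>
    also have "w x * (x * mix (\<mu> + 2) x t - \<mu> * mix (\<mu> + 1) x t) = x * uxx x t - (\<mu> - 2) * ux x t"
      using x by (simp add: uxx_def ux_def field_simps power2_eq_square)
    finally have val: "x * uxx x t - (\<mu> - 2) * ux x t = 1 / Gamma (1 - \<nu>) *
        (LINT s:{0<..<t}|lborel. (t - s) powr (- \<nu>) * deriv (\<lambda>r. u_tilde h \<mu> \<nu> x r) s)"
      using G by simp
    have "\<forall>s\<in>{0<..<t}. (\<lambda>r. u_tilde h \<mu> \<nu> x r) differentiable (at s)"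
      using dt unfolding real_differentiable_def by (metis greaterThanLessThan_iff)
    with int val show ?thesis
      using \<nu> unfolding has_caputo_derivative_def by simp
  qed
  show ?thesis
    using dx dxx caputo by blast
qed

text \<open>All derivatives are \<open>g_tilde\<close> times a rational function, because the
  logarithmic derivatives are (\<mu> - 1) / x - 1 / t in x and x / t^2 - \<mu> / t in t. The
  equation thus reduces to a rational identity.\<close>

lemma g_tilde_heat_equation:
  assumes \<mu>: "0 < \<mu>"
  shows "\<exists>ux uxx. \<forall>x>0. \<forall>t>0.
    ((\<lambda>y. g_tilde \<mu> y t) has_real_derivative ux x t) (at x) \<and>
    ((\<lambda>y. ux y t) has_real_derivative uxx x t) (at x) \<and>
    ((\<lambda>r. g_tilde \<mu> x r) has_real_derivative (x * uxx x t - (\<mu> - 2) * ux x t)) (at t)"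
proof -
  define ux where "ux = (\<lambda>x t. g_tilde \<mu> x t * ((\<mu> - 1) / x - 1 / t))"
  define uxx where "uxx = (\<lambda>x t. ux x t * ((\<mu> - 1) / x - 1 / t) + g_tilde \<mu> x t * (- (\<mu> - 1) / x\<^sup>2))"
  have G: "Gamma \<mu> \<noteq> 0"
    using Gamma_real_pos[OF \<mu>] by simp
  have 1: "((\<lambda>y. g_tilde \<mu> y t) has_real_derivative ux x t) (at x)" if "0 < x" "0 < t" for x t
  proof -
    have "((\<lambda>y. exp (- y / t)) has_real_derivative exp (- x / t) * (- 1 / t)) (at x)"
      using that by (auto intro!: derivative_eq_intros)
    from DERIV_mult[OF DERIV_cdivide[OF has_real_derivative_powr[OF that(1)]] this]
    show ?thesis
      unfolding ux_def g_tilde_def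
      by (rule DERIV_cong) (use that G in \<open>simp add: powr_diff field_simps power2_eq_square\<close>)
  qed
  have 2: "((\<lambda>y. ux y t) has_real_derivative uxx x t) (at x)" if "0 < x" "0 < t" for x t
  proof -
    have "((\<lambda>y. (\<mu> - 1) / y - 1 / t) has_real_derivative - (\<mu> - 1) / x\<^sup>2) (at x)"
      using that by (auto intro!: derivative_eq_intros simp: power2_eq_square)
    from DERIV_mult[OF 1[OF that] this] show ?thesis
      unfolding ux_def[abs_def] uxx_def by (simp add: ux_def algebra_simps)
  qed
  have 3: "((\<lambda>r. g_tilde \<mu> x r) has_real_derivative g_tilde \<mu> x t * (x / t\<^sup>2 - \<mu> / t)) (at t)" if "0 < x" "0 < t" for x t
  proof -
    have eq: "g_tilde \<mu> x r = x powr (\<mu> - 1) / Gamma \<mu> * (r powr (- \<mu>) * exp (- x / r))" for r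
      by (simp add: g_tilde_def powr_minus_divide)
    have "((\<lambda>r. exp (- x / r)) has_real_derivative exp (- x / t) * (x / t\<^sup>2)) (at t)"
      using that by (auto intro!: derivative_eq_intros simp: power2_eq_square)
    from DERIV_cmult[OF DERIV_mult[OF has_real_derivative_powr[OF that(2)] this]]
    show ?thesis
      unfolding eq
      by (rule DERIV_cong) (use that G in \<open>simp add: powr_diff field_simps power2_eq_square\<close>)
  qed
  have 4: "g_tilde \<mu> x t * (x / t\<^sup>2 - \<mu> / t) = x * uxx x t - (\<mu> - 2) * ux x t" if "0 < x" "0 < t" for x t
    using that by (simp add: uxx_def ux_def field_simps power2_eq_square)
  show ?thesis
    using 1 2 3 4 by metis
qed

theorem corollary2:
  fixes \<mu> \<nu> :: real
    and M :: "'a measure" and \<tau> :: "real \<Rightarrow> 'a \<Rightarrow> real"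
    and h :: "real \<Rightarrow> real \<Rightarrow> real"
  assumes "0 < \<mu>" and "0 < \<nu>" and "\<nu> \<le> 1"
    and "\<nu> < 1 \<Longrightarrow> stable_subordinator M \<tau> \<nu>"
    and "\<nu> < 1 \<Longrightarrow> density_of_subordinator M \<tau> h"
  shows "\<exists>u\<^sub>x u\<^sub>x\<^sub>x. \<forall>x>0. \<forall>t>0.
    ((\<lambda>y. u_tilde h \<mu> \<nu> y t) has_real_derivative u\<^sub>x x t) (at x) \<and>
    ((\<lambda>y. u\<^sub>x y t) has_real_derivative u\<^sub>x\<^sub>x x t) (at x) \<and>
    has_caputo_derivative \<nu> (\<lambda>r. u_tilde h \<mu> \<nu> x r)
      (x * u\<^sub>x\<^sub>x x t - (\<mu> - 2) * u\<^sub>x x t) t"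
proof (cases "\<nu> < 1")
  case True
  then have "stable_density \<nu> h"
    using stable_subordinator.stable_density assms(4,5) by blast
  then show ?thesis
    by (rule stable_density.u_tilde_fractional_equation[OF _ assms(1)])
next
  case False
  then have "\<nu> = 1"
    using assms(3) by simp
  then show ?thesis
    using g_tilde_heat_equation[OF assms(1)] by (simp add: u_tilde_def has_caputo_derivative_def)
qed

end
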